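(* For the 4-dimensional Lagrange top, the following stability results apply to the relative equilibria in the full reduced space. 1. All upright relative equilibria, that is, those with $\theta<\pi/2$, are linearly unstable. 2. All hanging relative equilibria, that is, those with $\theta>\pi/2$, and all horizontal relative equilibria, that is, those with $\theta=\pi/2$, excluding those which are isosceles, are Lyapunov stable.
   Context: **The Lagrange top.** The 4-dimensional Lagrange top is the Hamiltonian system on $T^*SO(4)$ with Hamiltonian $\frac12\langle L,\mathbb I^{-1}(L)\rangle+\gamma\langle a c_0,v_0\rangle$, where $a\in SO(4)$ is the configuration, $L\in\mathfrak{so}(4)^*$ the body angular momentum, $\gamma>0$ a constant, $c_0=v_0\in\mathbb R^4$ the (initially aligned) unit body-axis and vertical vectors, and $\mathbb I(\omega)=\frac12(A\omega+\omega A)$ with $A=\mathrm{diag}(1,1,1,I_4)$ in a basis whose last vector is the vertical, $I_4>0$. It is symmetric under left and right multiplication by the subgroup $SO(3)$ fixing the vertical. Put $\alpha=2(1+I_4)^{-1}>0$, and let $\theta\in[0,\pi]$ be the angle between the body axis $ac_0$ and the vertical. **Full reduced space.** Let $\mathbb H$ be the quaternions with inner product $\langle p,q\rangle=\frac12(pq^\dagger+qp^\dagger)$, and $G$ the group of unit quaternions, with $\mathfrak g=\mathrm{Im}\,\mathbb H\cong\mathbb R^3$. Through the double cover $G\times G\to SO(4)$, $(g_1,g_2)\mapsto(q\mapsto g_1qg_2^{-1})$, with the vertical equal to $1\in\mathbb H$, the system lifts to $T^*(G\times G)=\{(g_1,p_1,g_2,p_2)\in\mathbb H^4:g_i\in G,\langle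 p_i,g_i\rangle=0\}$ with symmetry group $G_L\times G_R$ (two copies of $G$) acting on each entry by $q\mapsto lqs^{-1}$, $(l,s)\in G_L\times G_R$, and momenta $\lambda=p_1g_1^{-1}+p_2g_2^{-1}$, $\rho=g_1^{-1}p_1+g_2^{-1}p_2$. Put $R_i=g_i^{-1}p_i$ and $g_L=g_1^{-1}g_2=r+\overline g_L$ with real part $r=\cos\theta$ and imaginary part $\overline g_L$. The full reduced space $(M_\lambda)_\rho$ is $$\{(R_1,R_2,g_L)\in\mathfrak g\times\mathfrak g\times\mathbb H:\ |g_L|=1,\ |R_1g_L+g_LR_2|=|\lambda|,\ |R_1+R_2|=|\rho|\}/G_R,$$ where $G_R=G$ acts by simultaneous conjugation. Up to a Casimir (which does not alter the flow) the reduced Hamiltonian is $\frac{\alpha}{2}(|R_1|^2+|R_2|^2)+\gamma r$, and the reduced flow on $(M_\lambda)_\rho$ is the one induced by $$\dot R_1=-\gamma\,\overline g_L,\qquad \dot R_2=\gamma\,\overline g_L,\qquad \dot g_L=\alpha(-R_1g_L+g_LR_2).$$ **Terminology.** A relative equilibrium is a solution which is the orbit of a one-parameter subgroup of the symmetry group, equivalently a fixed point of the flow on the full reduced space; $\theta$ is constant along it. It is linearly unstable if the linearisation of the reduced flow at the fixed point has an eigenvalue with non-zero real part. A horizontal relative equilibrium ($\theta=\pi/2$) is called isosceles if $|R_1|=|R_2|$. *)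

theory Defs
  imports "HOL-Analysis.Analysis"
begin

section \<open>Quaternions\<close>

text \<open>A quaternion is the pair of its real and its imaginary part. The inner product and the norm
  that the product type carries are the usual ones, i.e. \<open>\<langle>p,q\<rangle> = (p q\<^sup>\<dagger> + q p\<^sup>\<dagger>) / 2\<close>.\<close>

type_synonym quat = "real \<times> (real ^ 3)"

definition qmult :: "quat \<Rightarrow> quat \<Rightarrow> quat" (infixl "\<odot>" 70) where
  "p \<odot> q = (fst p * fst q - snd p \<bullet> snd q,
            fst p *\<^sub>R snd q + fst q *\<^sub>R snd p + cross3 (snd p) (snd q))"

definition qconj :: "quat \<Rightarrow> quat" where
  "qconj q = (fst q, - snd q)"

definition im_part :: "quat \<Rightarrow> quat" where
  "im_part q = (0, snd q)"

definition Im_quat :: "quat set" where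
  "Im_quat = {q. fst q = 0}"

section \<open>The full reduced space\<close>

type_synonym state = "quat \<times> quat \<times> quat"

definition level_set :: "quat \<Rightarrow> quat \<Rightarrow> state set" where
  "level_set lam rho =
     {(R1, R2, g). R1 \<in> Im_quat \<and> R2 \<in> Im_quat \<and> norm g = 1 \<and>
        norm (R1 \<odot> g + g \<odot> R2) = norm lam \<and> norm (R1 + R2) = norm rho}"

text \<open>The action of the unit quaternion \<open>s\<close>; for such \<open>s\<close> the inverse is the conjugate.\<close>

definition conj_act :: "quat \<Rightarrow> state \<Rightarrow> state" where
  "conj_act s = (\<lambda>(R1, R2, g). (s \<odot> R1 \<odot> qconj s, s \<odot> R2 \<odot> qconj s, s \<odot> g \<odot> qconj s))"

definition orbit :: "state \<Rightarrow> state set" where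
  "orbit x = {conj_act s x | s. norm s = 1}"

definition full_reduced_space :: "quat \<Rightarrow> quat \<Rightarrow> state set set" where
  "full_reduced_space lam rho = orbit ` level_set lam rho"

text \<open>The quotient topology.\<close>

definition reduced_topology :: "quat \<Rightarrow> quat \<Rightarrow> state set topology" where
  "reduced_topology lam rho =
     topology (\<lambda>U. U \<subseteq> full_reduced_space lam rho \<and>
       openin (top_of_set (level_set lam rho)) {x \<in> level_set lam rho. orbit x \<in> U})"

lemma openin_reduced_topology:
  "openin (reduced_topology lam rho) U \<longleftrightarrow>
     U \<subseteq> full_reduced_space lam rho \<and>
     openin (top_of_set (level_set lam rho)) {x \<in> level_set lam rho. orbit x \<in> U}"
proof -
  let ?S = "level_set lam rho"
  let ?P = "\<lambda>U. U \<subseteq> full_reduced_space lam rho \<and>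
     openin (top_of_set ?S) {x \<in> ?S. orbit x \<in> U}"
  have "istopology ?P"
    unfolding istopology_def
  proof (intro conjI allI impI)
    fix U V assume U: "?P U" and V: "?P V"
    show "U \<inter> V \<subseteq> full_reduced_space lam rho" using U by blast
    have eq: "{x \<in> ?S. orbit x \<in> U \<inter> V} = {x \<in> ?S. orbit x \<in> U} \<inter> {x \<in> ?S. orbit x \<in> V}"
      by blast
    show "openin (top_of_set ?S) {x \<in> ?S. orbit x \<in> U \<inter> V}"
      unfolding eq using U V by (intro openin_Int) auto
  next
    fix K assume K: "\<forall>U\<in>K. ?P U"
    then show "\<Union>K \<subseteq> full_reduced_space lam rho" by blast
    have eq: "{x \<in> ?S. orbit x \<in> \<Union>K} = (\<Union>U\<in>K. {x \<in> ?S. orbit x \<in> U})" by blast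
    show "openin (top_of_set ?S) {x \<in> ?S. orbit x \<in> \<Union>K}"
      unfolding eq using K by (intro openin_Union) auto
  qed
  then show ?thesis
    unfolding reduced_topology_def by (simp add: topology_inverse')
qed

section \<open>The reduced flow\<close>

definition top_alpha :: "real \<Rightarrow> real" where
  "top_alpha I4 = 2 / (1 + I4)"

definition top_field :: "real \<Rightarrow> real \<Rightarrow> state \<Rightarrow> state" where
  "top_field \<alpha> \<gamma> = (\<lambda>(R1, R2, g).
     (- \<gamma> *\<^sub>R im_part g, \<gamma> *\<^sub>R im_part g, \<alpha> *\<^sub>R (- (R1 \<odot> g) + g \<odot> R2)))"

text \<open>The trajectories of the reduced flow over the time interval \<open>J\<close> are the projections of
  the solutions upstairs.\<close>

definition reduced_trajectory ::
    "real \<Rightarrow> real \<Rightarrow> quat \<Rightarrow> quat \<Rightarrow> real set \<Rightarrow> (real \<Rightarrow> state set) \<Rightarrow> bool" where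
  "reduced_trajectory \<alpha> \<gamma> lam rho J \<Gamma> \<longleftrightarrow>
     (\<exists>c. (\<forall>t\<in>J. c t \<in> level_set lam rho \<and> \<Gamma> t = orbit (c t) \<and>
              (c has_vector_derivative top_field \<alpha> \<gamma> (c t)) (at t within J)))"

definition relative_equilibrium ::
    "real \<Rightarrow> real \<Rightarrow> quat \<Rightarrow> quat \<Rightarrow> state set \<Rightarrow> bool" where
  "relative_equilibrium \<alpha> \<gamma> lam rho p \<longleftrightarrow>
     p \<in> full_reduced_space lam rho \<and> reduced_trajectory \<alpha> \<gamma> lam rho UNIV (\<lambda>t. p)"

text \<open>The angle between the body axis and the vertical, determined by \<open>Re g\<^sub>L = cos \<theta>\<close> and
  \<open>\<theta> \<in> [0, \<pi>]\<close>.\<close>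

definition top_angle :: "quat \<Rightarrow> real" where
  "top_angle g = arccos (fst g)"

definition lyapunov_stable ::
    "real \<Rightarrow> real \<Rightarrow> quat \<Rightarrow> quat \<Rightarrow> state set \<Rightarrow> bool" where
  "lyapunov_stable \<alpha> \<gamma> lam rho p \<longleftrightarrow>
     (\<forall>U. openin (reduced_topology lam rho) U \<and> p \<in> U \<longrightarrow>
       (\<exists>V. openin (reduced_topology lam rho) V \<and> p \<in> V \<and>
         (\<forall>T\<ge>0. \<forall>\<Gamma>. reduced_trajectory \<alpha> \<gamma> lam rho {0..T} \<Gamma> \<and> \<Gamma> 0 \<in> V \<longrightarrow> \<Gamma> T \<in> U)))"

section \<open>The linearisation of the reduced flow\<close>

text \<open>\<open>C\<^sup>\<infinity>\<close> functions: differentiable everywhere, with all directional derivatives again \<open>C\<^sup>\<infinity>\<close>.\<close>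

coinductive smooth :: "('a::euclidean_space \<Rightarrow> real) \<Rightarrow> bool" where
  "\<lbrakk>\<And>x. f differentiable (at x); \<And>v. smooth (\<lambda>x. frechet_derivative f (at x) v)\<rbrakk> \<Longrightarrow> smooth f"

text \<open>The full reduced space is singular at some of the fixed points (those with \<open>\<theta> = 0\<close> or
  \<open>\<theta> = \<pi>\<close>). As usual in singular reduction, its smooth functions are the restrictions to the level
  set of the smooth invariant functions, and its tangent space at \<open>orbit x\<close> is the space of
  derivations at \<open>x\<close> of this algebra; where the reduced space is a manifold this is the ordinary
  tangent space. Eigenvalues may be complex, so we work in the complexified tangent space, whose
  elements are the complex-valued derivations.\<close>

definition invariant_functions :: "(state \<Rightarrow> real) set" where
  "invariant_functions = {f. smooth f \<and> (\<forall>s y. norm s = 1 \<longrightarrow> f (conj_act s y) = f y)}"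

definition reduced_tangent_vector ::
    "quat \<Rightarrow> quat \<Rightarrow> state \<Rightarrow> ((state \<Rightarrow> real) \<Rightarrow> complex) \<Rightarrow> bool" where
  "reduced_tangent_vector lam rho x v \<longleftrightarrow>
     (\<forall>f\<in>invariant_functions. \<forall>h\<in>invariant_functions. \<forall>a b.
        v (\<lambda>y. a * f y + b * h y) = of_real a * v f + of_real b * v h) \<and>
     (\<forall>f\<in>invariant_functions. \<forall>h\<in>invariant_functions.
        v (\<lambda>y. f y * h y) = of_real (f x) * v h + of_real (h x) * v f) \<and>
     (\<forall>f\<in>invariant_functions. (\<forall>y\<in>level_set lam rho. f y = 0) \<longrightarrow> v f = 0)"

text \<open>The time derivative of a function along the flow. The vector field is equivariant and tangent
  to the level sets, so this is a derivation of the algebra of smooth functions on the reduced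
  space.\<close>

definition flow_derivative :: "real \<Rightarrow> real \<Rightarrow> (state \<Rightarrow> real) \<Rightarrow> state \<Rightarrow> real" where
  "flow_derivative \<alpha> \<gamma> f = (\<lambda>y. frechet_derivative f (at y) (top_field \<alpha> \<gamma> y))"

text \<open>At a fixed point, the linearisation maps the tangent vector \<open>v\<close> to the tangent vector
  \<open>f \<mapsto> v (flow_derivative \<alpha> \<gamma> f)\<close>: this is the time derivative at \<open>t = 0\<close> of
  \<open>f \<mapsto> v (f \<circ> \<Phi>\<^sub>t)\<close>, the image of \<open>v\<close> under the differential of the time-\<open>t\<close> flow \<open>\<Phi>\<^sub>t\<close>.\<close>

definition linearisation_eigenvalue ::
    "real \<Rightarrow> real \<Rightarrow> quat \<Rightarrow> quat \<Rightarrow> state \<Rightarrow> complex \<Rightarrow> bool" where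
  "linearisation_eigenvalue \<alpha> \<gamma> lam rho x \<mu> \<longleftrightarrow>
     (\<exists>v. reduced_tangent_vector lam rho x v \<and>
          (\<exists>f\<in>invariant_functions. v f \<noteq> 0) \<and>
          (\<forall>f\<in>invariant_functions. v (flow_derivative \<alpha> \<gamma> f) = \<mu> * v f))"

text \<open>By invariance these notions depend on the representative \<open>x\<close> only through \<open>orbit x\<close>.\<close>

definition linearly_unstable ::
    "real \<Rightarrow> real \<Rightarrow> quat \<Rightarrow> quat \<Rightarrow> state \<Rightarrow> bool" where
  "linearly_unstable \<alpha> \<gamma> lam rho x \<longleftrightarrow>
     (\<exists>\<mu>. linearisation_eigenvalue \<alpha> \<gamma> lam rho x \<mu> \<and> Re \<mu> \<noteq> 0)"

end

theory Submission
  imports Defs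
begin

text \<open>With \<open>S = R\<^sub>1 + R\<^sub>2\<close>, \<open>D = R\<^sub>1 - R\<^sub>2\<close> and \<open>g\<^sub>L = r + G\<close>, the vector \<open>S\<close> is constant and the
  invariants \<open>r\<close>, \<open>u = D \<bullet> G\<close>, \<open>k = D \<bullet> D\<close>, \<open>m = S \<bullet> D\<close>, \<open>w = S \<bullet> G\<close>, \<open>d = S \<bullet> (D \<times> G)\<close> satisfy a closed
  system in which \<open>m' = - 2 \<gamma> w\<close> and \<open>w' = - \<alpha> r m\<close>. Besides the energy \<open>\<beta> k + r\<close>, with
  \<open>\<beta> = \<alpha> / (4 \<gamma>)\<close>, it conserves \<open>d + |S|\<^sup>2 r + \<beta> m\<^sup>2\<close>. At a hanging or a non-isosceles horizontal
  equilibrium the two conserved quantities isolate the equilibrium in the reduced space, and a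
  compactness argument gives Lyapunov stability. At an upright equilibrium the equations for \<open>m\<close>
  and \<open>w\<close> are hyperbolic, with exponents \<open>\<plusminus> sqrt (2 \<alpha> \<gamma> r)\<close>; the eigenvector is realised by a curve in
  the level set. Only when \<open>S = D = G = 0\<close>, where \<open>m\<close> and \<open>w\<close> vanish identically, does one have to
  pass to second order.\<close>

text \<open>Near an equilibrium with \<open>m = 0\<close> the two equations for \<open>m\<close> and
  \<open>w\<close> give m'' = 2 \<alpha> \<gamma> r m to first order, so the sign of
  \<open>r\<close> separates hyperbolic from elliptic behaviour. At r = 0 the equilibrium conditions
  leave \<open>m\<close> free; since S \<bullet> D = |R_1|^2 - |R_2|^2, the isosceles equilibria are
  those with m = 0. For stability the reduced space is replaced by points of R^6 subject to two
  polynomial relations, so that isolation becomes a question about polynomials. To return to orbits,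
  D \<times> G serves as a third basis vector; the hanging equilibrium with D = G = 0 is treated
  apart, where the energy has a minimum. For instability the obstacle is that a tangent vector must
  annihilate every invariant function vanishing on the level set. An eigenvector of the equations
  for \<open>m\<close> and \<open>w\<close> is therefore not enough by itself: it has to be the
  velocity of a curve lying exactly in the level set, and this is the origin of the square roots in
  the three constructions.\<close>

section \<open>Conjugation by unit quaternions\<close>

lemma qmult_assoc: "p \<odot> q \<odot> s = p \<odot> (q \<odot> s)"
  by (simp add: qmult_def cross3_simps vec_eq_iff forall_3 inner_vec_def sum_3 algebra_simps)

lemma qmult_qconj: "s \<odot> qconj s = ((norm s)\<^sup>2, 0)" "qconj s \<odot> s = ((norm s)\<^sup>2, 0)"
  by (cases s; simp add: qmult_def qconj_def norm_Pair power2_eq_square flip: power2_norm_eq_inner)+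

lemma qmult_scalar: "(a, 0) \<odot> q = a *\<^sub>R q" "q \<odot> (a, 0) = a *\<^sub>R q"
  by (cases q; simp add: qmult_def)+

definition rot :: "quat \<Rightarrow> real ^ 3 \<Rightarrow> real ^ 3" where
  "rot s x = ((fst s)\<^sup>2 - snd s \<bullet> snd s) *\<^sub>R x + (2 * (snd s \<bullet> x)) *\<^sub>R snd s
     + (2 * fst s) *\<^sub>R cross3 (snd s) x"

lemma conj_rot: "s \<odot> (p, x) \<odot> qconj s = ((norm s)\<^sup>2 * p, rot s x)"
proof -
  obtain a v where s: "s = (a, v)" by (cases s)
  have n: "(norm s)\<^sup>2 = a\<^sup>2 + v \<bullet> v"
    by (simp add: s norm_Pair flip: power2_norm_eq_inner)
  show ?thesis unfolding n
    by (simp add: s qmult_def qconj_def rot_def cross3_simps vec_eq_iff forall_3 inner_vec_def sum_3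
        algebra_simps power2_eq_square)
qed

lemma rot_linear: "linear (rot s)"
  by (rule linearI) (simp_all add: rot_def cross3_simps algebra_simps inner_simps)

lemmas rot_simps = linear_add[OF rot_linear] linear_diff[OF rot_linear] linear_scale[OF rot_linear]
  linear_0[OF rot_linear]

text \<open>Conjugation is multiplicative, and a product of two imaginary quaternions has real part
  - (x \<bullet> y) and imaginary part the cross product. Hence both are respected at once.\<close>

lemma rot_products:
  assumes "norm s = 1"
  shows rot_inner: "rot s x \<bullet> rot s y = x \<bullet> y"
    and rot_cross: "cross3 (rot s x) (rot s y) = rot s (cross3 x y)"
proof -
  have "s \<odot> (0, x) \<odot> qconj s \<odot> (s \<odot> (0, y) \<odot> qconj s)
      = s \<odot> (0, x) \<odot> (qconj s \<odot> s) \<odot> ((0, y) \<odot> qconj s)"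
    by (simp only: qmult_assoc)
  also have "\<dots> = s \<odot> ((0, x) \<odot> (0, y)) \<odot> qconj s"
    by (simp add: qmult_qconj assms qmult_scalar) (simp only: qmult_assoc)
  finally have "(0, rot s x) \<odot> (0, rot s y) = s \<odot> ((0, x) \<odot> (0, y)) \<odot> qconj s"
    by (simp add: conj_rot assms)
  moreover have "(0, x) \<odot> (0, y) = (- (x \<bullet> y), cross3 x y)"
    by (simp add: qmult_def)
  ultimately have "(0, rot s x) \<odot> (0, rot s y) = (- (x \<bullet> y), rot s (cross3 x y))"
    by (simp add: conj_rot assms)
  then show "rot s x \<bullet> rot s y = x \<bullet> y" "cross3 (rot s x) (rot s y) = rot s (cross3 x y)"
    by (simp_all add: qmult_def)
qed

lemma qconj_qmult: "qconj (p \<odot> q) = qconj q \<odot> qconj p"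
  by (simp add: qconj_def qmult_def inner_commute algebra_simps cross_skew[of "snd p" "snd q"])

lemma qmult_scaleR: "(a *\<^sub>R p) \<odot> q = a *\<^sub>R (p \<odot> q)"
  by (simp add: qmult_def cross_mult_left algebra_simps)

lemma norm_qmult: "norm (p \<odot> q) = norm p * norm q"
proof -
  have "((norm (p \<odot> q))\<^sup>2, 0) = p \<odot> (q \<odot> qconj q) \<odot> qconj p"
    by (simp only: qmult_qconj(1)[symmetric] qconj_qmult) (simp only: qmult_assoc)
  also have "\<dots> = ((norm p * norm q)\<^sup>2, 0)"
    by (simp add: qmult_qconj qmult_scalar qmult_scaleR power_mult_distrib)
  finally show ?thesis by simp
qed

lemma conj_act_rot:
  assumes "norm s = 1"
  shows "conj_act s ((a, x), (b, y), (c, z)) = ((a, rot s x), (b, rot s y), (c, rot s z))"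
  by (simp add: conj_act_def conj_rot assms)

lemma conj_act_mult: "conj_act s (conj_act t y) = conj_act (s \<odot> t) y"
  by (cases y) (simp add: conj_act_def qconj_qmult qmult_assoc)

lemma norm_qconj [simp]: "norm (qconj s) = norm s"
  by (simp add: qconj_def norm_prod_def)

lemma conj_act_qconj:
  assumes "norm s = 1"
  shows "conj_act (qconj s) (conj_act s y) = y"
proof -
  have "qconj s \<odot> s = (1, 0)" by (simp add: qmult_qconj assms)
  moreover have "conj_act (1, 0) y = y"
    by (cases y) (simp add: conj_act_def qmult_scalar, simp add: qconj_def qmult_scalar)
  ultimately show ?thesis by (simp add: conj_act_mult)
qed

lemma mem_orbit_refl: "y \<in> orbit y"
  unfolding orbit_def by (rule CollectI, rule exI[of _ "(1, 0)"])
    (cases y, simp add: conj_act_def qmult_scalar, simp add: qconj_def qmult_scalar)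

lemma orbit_conj_act:
  assumes "norm s = 1"
  shows "orbit (conj_act s y) = orbit y"
proof
  show "orbit (conj_act s y) \<subseteq> orbit y"
    unfolding orbit_def using assms by (fastforce simp: conj_act_mult norm_qmult)
  show "orbit y \<subseteq> orbit (conj_act s y)"
  proof
    fix z assume "z \<in> orbit y"
    then obtain t where t: "norm t = 1" "z = conj_act t y" by (auto simp: orbit_def)
    then have "z = conj_act (t \<odot> qconj s) (conj_act s y)"
      using assms by (simp add: conj_act_qconj flip: conj_act_mult)
    moreover have "norm (t \<odot> qconj s) = 1" by (simp add: norm_qmult t assms)
    ultimately show "z \<in> orbit (conj_act s y)" unfolding orbit_def by blast
  qed
qed

lemma orbit_eqD: "orbit y = orbit z \<Longrightarrow> \<exists>s. norm s = 1 \<and> y = conj_act s z"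
  using mem_orbit_refl[of y] by (auto simp: orbit_def)

section \<open>Half-turns, and rotations between isometric pairs\<close>

lemma half_turn:
  assumes "norm n = 1"
  shows "rot (0, n) x = (2 * (n \<bullet> x)) *\<^sub>R n - x"
  using assms by (simp add: rot_def flip: power2_norm_eq_inner)

lemma exists_orthogonal_unit3:
  fixes a b :: "real ^ 3"
  shows "\<exists>n. norm n = 1 \<and> n \<bullet> a = 0 \<and> n \<bullet> b = 0"
proof -
  have "dim {a, b} \<le> card {a, b}" by (rule dim_le_card) (auto simp: span_superset)
  also have "\<dots> \<le> 2" by (simp add: card_insert_if)
  finally have "dim {a, b} < DIM(real ^ 3)" by simp
  then obtain x where x: "x \<noteq> 0" "\<And>y. y \<in> span {a, b} \<Longrightarrow> orthogonal x y"
    by (metis orthogonal_to_subspace_exists)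
  then have "orthogonal x a" "orthogonal x b" by (simp_all add: span_base)
  then show ?thesis using x(1)
    by (intro exI[of _ "x /\<^sub>R norm x"]) (simp add: orthogonal_def)
qed

text \<open>The half-turn about the bisector of \<open>x\<close> and \<open>y\<close> exchanges
  them, and the second hypothesis makes this axis orthogonal to \<open>b\<close>. If y = - x there
  is no bisector, and an axis orthogonal to both \<open>x\<close> and \<open>b\<close> is taken
  instead.\<close>

lemma half_turn_exists:
  fixes b x y :: "real ^ 3"
  assumes "x \<bullet> x = y \<bullet> y" "b \<bullet> x = - (b \<bullet> y)"
  shows "\<exists>n. norm n = 1 \<and> n \<bullet> b = 0 \<and> rot (0, n) x = y"
proof (cases "x + y = 0")
  case True
  then have y: "y = - x" by (simp add: eq_neg_iff_add_eq_0 add.commute)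
  obtain n where "norm n = 1" "n \<bullet> b = 0" "n \<bullet> x = 0"
    using exists_orthogonal_unit3 by blast
  then show ?thesis by (intro exI[of _ n]) (simp add: half_turn y)
next
  case False
  let ?n = "(x + y) /\<^sub>R norm (x + y)"
  have n: "norm ?n = 1" using False by simp
  have "norm (x + y) * norm (x + y) = (x + y) \<bullet> (x + y)"
    by (simp add: power2_norm_eq_inner flip: power2_eq_square)
  also have "\<dots> = 2 * ((x + y) \<bullet> x)"
    unfolding inner_simps assms(1) by (simp add: inner_commute)
  finally have N: "2 * ((x + y) \<bullet> x) = norm (x + y) * norm (x + y)" ..
  have "2 * (inverse (norm (x + y)) * ((x + y) \<bullet> x)) * inverse (norm (x + y))
      = 2 * ((x + y) \<bullet> x) * (inverse (norm (x + y)) * inverse (norm (x + y)))"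
    by (simp only: ac_simps)
  also have "\<dots> = 1" unfolding N using False by (simp add: field_simps)
  finally have "(2 * (?n \<bullet> x)) *\<^sub>R ?n = x + y"
    by (simp only: inner_scaleR_left scaleR_scaleR scaleR_one)
  then have "rot (0, ?n) x = y" using half_turn[OF n] by simp
  moreover have "?n \<bullet> b = 0"
    using assms(2) by (simp add: inner_simps inner_commute)
  ultimately show ?thesis using n by blast
qed

text \<open>Two half-turns carry a pair to any isometric pair: the first one aligns \<open>x\<close> with \<open>- x'\<close>, the
  second one, about an axis orthogonal to \<open>x'\<close>, reverses this sign.\<close>

lemma rot_pair_exists:
  fixes x y x' y' :: "real ^ 3"
  assumes "x \<bullet> x = x' \<bullet> x'" "y \<bullet> y = y' \<bullet> y'" "x \<bullet> y = x' \<bullet> y'"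
  shows "\<exists>s. norm s = 1 \<and> rot s x = x' \<and> rot s y = y'"
proof -
  obtain n where n: "norm n = 1" "rot (0, n) x = - x'"
    using half_turn_exists[of x "- x'" 0] assms by auto
  have n1: "norm (0::real, n) = 1" by (simp add: norm_Pair n)
  have "rot (0, n) y \<bullet> rot (0, n) y = y' \<bullet> y'" "x' \<bullet> rot (0, n) y = - (x' \<bullet> y')"
    using rot_inner[OF n1, of y y] rot_inner[OF n1, of x y] n assms by simp_all
  then obtain m where m: "norm m = 1" "m \<bullet> x' = 0" "rot (0, m) (rot (0, n) y) = y'"
    using half_turn_exists by metis
  let ?s = "(0, m) \<odot> (0, n)"
  have m1: "norm (0::real, m) = 1" by (simp add: norm_Pair m)
  have s: "norm ?s = 1" by (simp only: norm_qmult n1 m1 mult_1)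
  have comp: "rot ?s z = rot (0, m) (rot (0, n) z)" for z
    using conj_act_mult[of "(0, m)" "(0, n)" "((0, z), (0, z), (0, z))"]
    by (simp only: conj_act_rot[OF s] conj_act_rot[OF n1] conj_act_rot[OF m1] prod.inject)
  have "rot ?s x = x'" unfolding comp n using m by (simp add: half_turn)
  with s m comp show ?thesis by blast
qed

section \<open>Invariants and reduced equations\<close>

definition sumR :: "state \<Rightarrow> real ^ 3" where
  "sumR y = snd (fst y) + snd (fst (snd y))"

definition difR :: "state \<Rightarrow> real ^ 3" where
  "difR y = snd (fst y) - snd (fst (snd y))"

definition vecG :: "state \<Rightarrow> real ^ 3" where
  "vecG y = snd (snd (snd y))"

definition reG :: "state \<Rightarrow> real" where
  "reG y = fst (snd (snd y))"

lemma bounded_linear_components: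
  "bounded_linear sumR" "bounded_linear difR" "bounded_linear vecG" "bounded_linear reG"
  by (simp_all add: linear_conv_bounded_linear[symmetric] linear_iff sumR_def difR_def vecG_def
      reG_def algebra_simps)

lemma continuous_on_components [continuous_intros]:
  "continuous_on A sumR" "continuous_on A difR" "continuous_on A vecG" "continuous_on A reG"
  by (simp_all add: bounded_linear_components linear_continuous_on)

lemma conj_act_components:
  assumes "norm s = 1"
  shows "sumR (conj_act s y) = rot s (sumR y)" "difR (conj_act s y) = rot s (difR y)"
    "vecG (conj_act s y) = rot s (vecG y)" "reG (conj_act s y) = reG y"
  using assms by (cases y; auto simp: conj_act_rot sumR_def difR_def vecG_def reG_def rot_simps)+

lemma state_eqI:
  assumes "fst (fst x) = fst (fst y)" "fst (fst (snd x)) = fst (fst (snd y))"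
    "sumR x = sumR y" "difR x = difR y" "vecG x = vecG y" "reG x = reG y"
  shows "x = y"
proof -
  have "2 *\<^sub>R snd (fst x) = sumR x + difR x" "2 *\<^sub>R snd (fst y) = sumR y + difR y"
    "2 *\<^sub>R snd (fst (snd x)) = sumR x - difR x" "2 *\<^sub>R snd (fst (snd y)) = sumR y - difR y"
    by (simp_all add: sumR_def difR_def scaleR_2)
  then have "2 *\<^sub>R snd (fst x) = 2 *\<^sub>R snd (fst y)"
    "2 *\<^sub>R snd (fst (snd x)) = 2 *\<^sub>R snd (fst (snd y))" using assms by metis+
  then show ?thesis using assms by (simp add: prod_eq_iff vecG_def reG_def)
qed

text \<open>For imaginary R_1 and R_2 the quaternion R_1 g + g R_2 has real part - (S \<bullet> G)
  and imaginary part r S + D \<times> G.\<close>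

lemma level_set_iff:
  "y \<in> level_set lam rho \<longleftrightarrow> fst (fst y) = 0 \<and> fst (fst (snd y)) = 0 \<and>
     (reG y)\<^sup>2 + vecG y \<bullet> vecG y = 1 \<and>
     (sumR y \<bullet> vecG y)\<^sup>2 + (norm (reG y *\<^sub>R sumR y + cross3 (difR y) (vecG y)))\<^sup>2 = (norm lam)\<^sup>2 \<and>
     norm (sumR y) = norm rho"
proof -
  obtain a A b B r G where y: "y = ((a, A), (b, B), (r, G))" by (metis surj_pair)
  show ?thesis
  proof (cases "a = 0 \<and> b = 0")
    case True
    then have y: "y = ((0, A), (0, B), (r, G))" by (simp add: y)
    have L: "(0, A) \<odot> (r, G) + (r, G) \<odot> (0, B)
        = (- (sumR y \<bullet> vecG y), reG y *\<^sub>R sumR y + cross3 (difR y) (vecG y))"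
      by (simp add: y qmult_def sumR_def difR_def vecG_def reG_def inner_commute algebra_simps
          cross_skew[of G B] Cross3.left_diff_distrib)
    have L2: "(norm (x, v))\<^sup>2 = x\<^sup>2 + (norm v)\<^sup>2" for x and v :: "real ^ 3"
      by (simp add: norm_prod_def)
    have "(norm (r, G))\<^sup>2 = r\<^sup>2 + G \<bullet> G"
      by (simp add: norm_prod_def flip: power2_norm_eq_inner)
    then have g: "norm (r, G) = 1 \<longleftrightarrow> r\<^sup>2 + G \<bullet> G = 1"
      by (metis norm_ge_zero one_power2 power2_eq_imp_eq zero_le_one)
    have "y \<in> level_set lam rho \<longleftrightarrow> norm (r, G) = 1 \<and>
        (norm ((0, A) \<odot> (r, G) + (r, G) \<odot> (0, B)))\<^sup>2 = (norm lam)\<^sup>2 \<and> norm (A + B) = norm rho"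
      by (simp add: y level_set_def Im_quat_def)
    then show ?thesis unfolding L g L2
      by (simp add: y sumR_def vecG_def reG_def)
  qed (auto simp: y level_set_def Im_quat_def)
qed

text \<open>Of the inner products among S, D and G only S \<bullet> S and G \<bullet> G are missing;
  on the level set these are |rho|^2 and 1 - r^2. The triple product records the
  orientation.\<close>

definition reduced_invariants :: "state \<Rightarrow> real \<times> real \<times> real \<times> real \<times> real \<times> real" where
  "reduced_invariants y = (reG y, difR y \<bullet> vecG y, difR y \<bullet> difR y, sumR y \<bullet> difR y,
     sumR y \<bullet> vecG y, sumR y \<bullet> cross3 (difR y) (vecG y))"

lemma continuous_on_reduced_invariants [continuous_intros]:
  "continuous_on A reduced_invariants"
  unfolding reduced_invariants_def
  by (intro continuous_intros continuous_on_cross)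

lemma reduced_invariants_conj_act:
  "norm s = 1 \<Longrightarrow> reduced_invariants (conj_act s y) = reduced_invariants y"
  by (simp add: reduced_invariants_def conj_act_components rot_inner rot_cross)

lemma reduced_invariants_orbit:
  "orbit x = orbit y \<Longrightarrow> reduced_invariants x = reduced_invariants y"
  using orbit_eqD reduced_invariants_conj_act by metis

lemma level_set_conj_act:
  assumes "norm s = 1" "y \<in> level_set lam rho"
  shows "conj_act s y \<in> level_set lam rho"
proof -
  have n: "norm (rot s x) = norm x" for x
    unfolding norm_eq_sqrt_inner rot_inner[OF assms(1)] ..
  have "fst (fst (conj_act s y)) = fst (fst y)" "fst (fst (snd (conj_act s y))) = fst (fst (snd y))"
    using assms(1) by (cases y; auto simp: conj_act_rot)+
  moreover have "reG y *\<^sub>R rot s (sumR y) + rot s (cross3 (difR y) (vecG y)) =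
      rot s (reG y *\<^sub>R sumR y + cross3 (difR y) (vecG y))"
    by (simp add: rot_simps)
  ultimately show ?thesis using assms
    by (simp add: level_set_iff conj_act_components rot_inner rot_cross n)
qed

section \<open>Relations between the invariants, and separation of orbits\<close>

lemma gram_det3:
  fixes a b c :: "real ^ 3"
  shows "(a \<bullet> cross3 b c)\<^sup>2 = (a \<bullet> a) * (b \<bullet> b) * (c \<bullet> c) - (a \<bullet> a) * (b \<bullet> c)\<^sup>2 - (a \<bullet> b)\<^sup>2 * (c \<bullet> c)
    + 2 * (a \<bullet> b) * (b \<bullet> c) * (a \<bullet> c) - (b \<bullet> b) * (a \<bullet> c)\<^sup>2"
  by (simp add: cross3_def inner_vec_def sum_3 power2_eq_square) (simp add: algebra_simps)

text \<open>The first relation expresses the level of |lam|, the second the Gram determinant of S,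
  D, G with \<open>s2\<close> for S \<bullet> S and 1 - r^2 for G \<bullet> G.\<close>

definition syzygies :: "real \<Rightarrow> real \<Rightarrow> real \<times> real \<times> real \<times> real \<times> real \<times> real \<Rightarrow> bool" where
  "syzygies s2 l2 = (\<lambda>(r, u, k, m, w, d).
     w\<^sup>2 + r\<^sup>2 * s2 + 2 * r * d + k * (1 - r\<^sup>2) - u\<^sup>2 = l2 \<and>
     d\<^sup>2 = s2 * k * (1 - r\<^sup>2) - s2 * u\<^sup>2 - m\<^sup>2 * (1 - r\<^sup>2) + 2 * m * u * w - k * w\<^sup>2)"

lemma level_set_inner:
  assumes "y \<in> level_set lam rho"
  shows "vecG y \<bullet> vecG y = 1 - (reG y)\<^sup>2" "sumR y \<bullet> sumR y = (norm rho)\<^sup>2"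
  using assms unfolding level_set_iff by (simp_all flip: power2_norm_eq_inner)

lemma level_set_syzygies:
  assumes "y \<in> level_set lam rho"
  shows "syzygies ((norm rho)\<^sup>2) ((norm lam)\<^sup>2) (reduced_invariants y)"
proof -
  define S D G r where *: "S = sumR y" "D = difR y" "G = vecG y" "r = reG y"
  have i: "G \<bullet> G = 1 - r\<^sup>2" "S \<bullet> S = (norm rho)\<^sup>2"
    using level_set_inner[OF assms] by (simp_all add: *)
  have "(norm (r *\<^sub>R S + cross3 D G))\<^sup>2
      = r\<^sup>2 * (S \<bullet> S) + 2 * r * (S \<bullet> cross3 D G) + (norm (cross3 D G))\<^sup>2"
    unfolding power2_norm_eq_inner inner_simps
    by (simp add: inner_commute algebra_simps power2_eq_square)
  also have "(norm (cross3 D G))\<^sup>2 = (D \<bullet> D) * (G \<bullet> G) - (D \<bullet> G)\<^sup>2"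
    using norm_cross_dot[of D G] by (simp add: power_mult_distrib power2_norm_eq_inner)
  finally show ?thesis
    using assms gram_det3[of S D G] unfolding level_set_iff
    by (simp add: syzygies_def reduced_invariants_def i flip: *)
qed

text \<open>The pairs (D, G) of the two states are isometric, so a rotation matches them. After that
  the two vectors S have equal inner products with the basis D, G, D \<times> G.\<close>

lemma separation:
  assumes "x \<in> level_set lam rho" "y \<in> level_set lam rho"
    and eq: "reduced_invariants y = reduced_invariants x"
    and nz: "cross3 (difR x) (vecG x) \<noteq> 0"
  shows "orbit y = orbit x"
proof -
  have i: "reG y = reG x" "difR y \<bullet> vecG y = difR x \<bullet> vecG x" "difR y \<bullet> difR y = difR x \<bullet> difR x"
    "sumR y \<bullet> difR y = sumR x \<bullet> difR x" "sumR y \<bullet> vecG y = sumR x \<bullet> vecG x"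
    "sumR y \<bullet> cross3 (difR y) (vecG y) = sumR x \<bullet> cross3 (difR x) (vecG x)"
    using eq by (simp_all add: reduced_invariants_def)
  obtain s where s: "norm s = 1" "rot s (difR x) = difR y" "rot s (vecG x) = vecG y"
    using rot_pair_exists[of "difR x" "difR y" "vecG x" "vecG y"] i level_set_inner[OF assms(1)]
      level_set_inner[OF assms(2)] by auto
  define z where "z = rot s (sumR x) - sumR y"
  have "z \<bullet> difR y = 0" "z \<bullet> vecG y = 0" "z \<bullet> cross3 (difR y) (vecG y) = 0"
    using i rot_inner[OF s(1), of "sumR x"] by (simp_all add: z_def inner_diff_left rot_cross s flip: s(2,3))
  moreover have "cross3 (difR y) (vecG y) \<noteq> 0"
    using nz rot_inner[OF s(1), of "cross3 (difR x) (vecG x)" "cross3 (difR x) (vecG x)"]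
    by (auto simp: s simp flip: rot_cross[OF s(1)])
  ultimately have "z = 0"
    using norm_and_cross_eq_0[of z "cross3 (difR y) (vecG y)"] by (simp add: Lagrange)
  then have "conj_act s x = y"
    using s i(1) assms(1,2) by (intro state_eqI)
      (auto simp: conj_act_components z_def level_set_iff level_set_conj_act[OF s(1) assms(1), unfolded level_set_iff])
  then show ?thesis using orbit_conj_act[OF s(1)] by metis
qed

section \<open>The closed system satisfied by the invariants\<close>

lemma top_field_components:
  assumes "y \<in> level_set lam rho"
  shows "sumR (top_field \<alpha> \<gamma> y) = 0" "difR (top_field \<alpha> \<gamma> y) = (- 2 * \<gamma>) *\<^sub>R vecG y"
    "reG (top_field \<alpha> \<gamma> y) = \<alpha> * (difR y \<bullet> vecG y)"
    "vecG (top_field \<alpha> \<gamma> y) = \<alpha> *\<^sub>R (- reG y *\<^sub>R difR y + cross3 (vecG y) (sumR y))"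
proof -
  obtain A B r G where y: "y = ((0, A), (0, B), (r, G))"
    using assms unfolding level_set_iff by (metis prod.collapse)
  show "sumR (top_field \<alpha> \<gamma> y) = 0" "difR (top_field \<alpha> \<gamma> y) = (- 2 * \<gamma>) *\<^sub>R vecG y"
    by (simp_all add: y top_field_def sumR_def difR_def vecG_def im_part_def vec_eq_iff)
  show "reG (top_field \<alpha> \<gamma> y) = \<alpha> * (difR y \<bullet> vecG y)"
    "vecG (top_field \<alpha> \<gamma> y) = \<alpha> *\<^sub>R (- reG y *\<^sub>R difR y + cross3 (vecG y) (sumR y))"
    by (simp_all add: y top_field_def sumR_def difR_def vecG_def reG_def qmult_def inner_commute
        algebra_simps cross_add_right cross_skew[of A G])
qed

lemma bounded_bilinear_cross3: "bounded_bilinear cross3"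
  using bilinear_cross by (simp add: bilinear_conv_bounded_bilinear)

lemma reduced_equations:
  assumes c: "(c has_vector_derivative top_field \<alpha> \<gamma> (c t)) (at t within J)"
    and l: "c t \<in> level_set lam rho"
    and i: "reduced_invariants (c t) = (r, u, k, m, w, d)"
  shows "((\<lambda>t. reG (c t)) has_vector_derivative \<alpha> * u) (at t within J)"
    "((\<lambda>t. difR (c t) \<bullet> vecG (c t)) has_vector_derivative
        - 2 * \<gamma> * (1 - r\<^sup>2) + \<alpha> * (d - r * k)) (at t within J)"
    "((\<lambda>t. difR (c t) \<bullet> difR (c t)) has_vector_derivative - 4 * \<gamma> * u) (at t within J)"
    "((\<lambda>t. sumR (c t) \<bullet> difR (c t)) has_vector_derivative - 2 * \<gamma> * w) (at t within J)"
    "((\<lambda>t. sumR (c t) \<bullet> vecG (c t)) has_vector_derivative - \<alpha> * r * m) (at t within J)"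
    "((\<lambda>t. sumR (c t) \<bullet> cross3 (difR (c t)) (vecG (c t))) has_vector_derivative
        \<alpha> * (m * w - (norm rho)\<^sup>2 * u)) (at t within J)"
proof -
  note comp = bounded_linear.has_vector_derivative[OF _ c]
  note S = comp[OF bounded_linear_components(1), unfolded top_field_components(1)[OF l]]
  note D = comp[OF bounded_linear_components(2), unfolded top_field_components(2)[OF l]]
  note G = comp[OF bounded_linear_components(3), unfolded top_field_components(4)[OF l]]
  note R = comp[OF bounded_linear_components(4), unfolded top_field_components(3)[OF l]]
  note inn = bounded_bilinear.has_vector_derivative[OF bounded_bilinear_inner]
  note crs = bounded_bilinear.has_vector_derivative[OF bounded_bilinear_cross3]
  note il = level_set_inner[OF l]
  have i': "reG (c t) = r" "difR (c t) \<bullet> vecG (c t) = u" "difR (c t) \<bullet> difR (c t) = k"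
    "sumR (c t) \<bullet> difR (c t) = m" "sumR (c t) \<bullet> vecG (c t) = w"
    "sumR (c t) \<bullet> cross3 (difR (c t)) (vecG (c t)) = d"
    using i by (simp_all add: reduced_invariants_def)
  have d': "difR (c t) \<bullet> cross3 (vecG (c t)) (sumR (c t)) = d"
    using cross_triple i'(6) by (metis inner_commute)
  show "((\<lambda>t. reG (c t)) has_vector_derivative \<alpha> * u) (at t within J)"
    using R i' by simp
  show "((\<lambda>t. difR (c t) \<bullet> vecG (c t)) has_vector_derivative
        - 2 * \<gamma> * (1 - r\<^sup>2) + \<alpha> * (d - r * k)) (at t within J)"
    using inn[OF D G] by (simp add: inner_simps il i' d' algebra_simps)
  show "((\<lambda>t. difR (c t) \<bullet> difR (c t)) has_vector_derivative - 4 * \<gamma> * u) (at t within J)"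
    using inn[OF D D] by (simp add: i' inner_commute[of "vecG (c t)"] mult.assoc)
  show "((\<lambda>t. sumR (c t) \<bullet> difR (c t)) has_vector_derivative - 2 * \<gamma> * w) (at t within J)"
    using inn[OF S D] by (simp add: i')
  show "((\<lambda>t. sumR (c t) \<bullet> vecG (c t)) has_vector_derivative - \<alpha> * r * m) (at t within J)"
    using inn[OF S G] by (simp add: inner_simps i' dot_cross_self mult.assoc)
  have L: "sumR (c t) \<bullet> cross3 (difR (c t)) (cross3 (vecG (c t)) (sumR (c t))) = m * w - (norm rho)\<^sup>2 * u"
    by (simp add: Lagrange inner_simps i' il inner_commute[of "difR (c t)" "sumR (c t)"])
  show "((\<lambda>t. sumR (c t) \<bullet> cross3 (difR (c t)) (vecG (c t))) has_vector_derivative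
        \<alpha> * (m * w - (norm rho)\<^sup>2 * u)) (at t within J)"
    using inn[OF S crs[OF D G]]
    by (simp add: inner_simps i' cross_mult_left cross_mult_right cross_add_right
        Cross3.right_diff_distrib L)
qed

section \<open>Isolation of equilibria by the conserved quantities\<close>

text \<open>For \<beta> = \<alpha> / (4 \<gamma>) this is the reduced Hamiltonian divided by
  \<gamma>, less the constant \<beta> |S|^2.\<close>

definition energy :: "real \<Rightarrow> real \<times> real \<times> real \<times> real \<times> real \<times> real \<Rightarrow> real" where
  "energy \<beta> = (\<lambda>(r, u, k, m, w, d). \<beta> * k + r)"

text \<open>Here d + s2 r is the inner product of S with the imaginary part of R_1 g + g R_2. It
  changes at the rate \<alpha> m w, while m^2 changes at the rate - 4 \<gamma> m w, which dictates
  the factor \<beta> = \<alpha> / (4 \<gamma>).\<close>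

definition charge :: "real \<Rightarrow> real \<Rightarrow> real \<times> real \<times> real \<times> real \<times> real \<times> real \<Rightarrow> real" where
  "charge \<beta> s2 = (\<lambda>(r, u, k, m, w, d). d + s2 * r + \<beta> * m\<^sup>2)"

text \<open>This is the second relation plus \<open>s2\<close> times the first. The left side is the
  square of the charge less \<beta> m^2, so on a fibre only a form in (m, w) remains.\<close>

lemma syzygies_square:
  "syzygies s2 l2 (r, u, k, m, w, d) \<Longrightarrow>
    (d + s2 * r)\<^sup>2 = s2 * l2 - m\<^sup>2 * (1 - r\<^sup>2) + 2 * m * u * w - (s2 + k) * w\<^sup>2"
  by (auto simp: syzygies_def power2_sum) (simp add: power2_eq_square algebra_simps)

definition isolated_in_fibre ::
    "real \<Rightarrow> real \<Rightarrow> real \<Rightarrow> real \<times> real \<times> real \<times> real \<times> real \<times> real \<Rightarrow> bool" where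
  "isolated_in_fibre \<beta> s2 l2 i0 \<longleftrightarrow> (\<forall>\<^sub>F i in nhds i0. syzygies s2 l2 i \<and>
     energy \<beta> i = energy \<beta> i0 \<and> charge \<beta> s2 i = charge \<beta> s2 i0 \<longrightarrow> i = i0)"

text \<open>Eliminating \<open>k\<close> and \<open>d\<close> by means of the conserved quantities, the two syzygies become a
  definite quadratic form in \<open>(m, w)\<close>, which forces \<open>m = w = 0\<close>, and then an equation
  \<open>u\<^sup>2 = F r\<close> where the cubic \<open>F\<close> has a strict local maximum with value \<open>0\<close> at \<open>r0\<close>.\<close>

lemma isolated_hanging:
  fixes \<beta> s2 l2 r0 k0 d0 :: real
  assumes \<beta>: "\<beta> > 0" and r0: "r0 < 0" and K: "s2 + k0 > 0"
    and d0: "2 * \<beta> * d0 = 2 * \<beta> * r0 * k0 + (1 - r0\<^sup>2)"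
    and syz: "syzygies s2 l2 (r0, 0, k0, 0, 0, d0)"
  shows "isolated_in_fibre \<beta> s2 l2 (r0, 0, k0, 0, 0, d0)"
proof -
  let ?i0 = "(r0, 0::real, k0, 0::real, 0::real, d0)"
  \<comment> \<open>Inserting the value of the charge into \<open>syzygies_square\<close> leaves A
    m^2 - 2 u m w + B w^2 = 0, and \<open>C\<close> is the determinant of this form. At the
    equilibrium A = - 2 \<beta> r0 (s2 + k0), which is positive because r0 is negative.\<close>
  define A where "A = (\<lambda>(r, u::real, k::real, m, w::real, d::real).
    1 - r\<^sup>2 - 2 * (d0 + s2 * r0) * \<beta> + \<beta>\<^sup>2 * m\<^sup>2)"
  define B where "B = (\<lambda>(r::real, u::real, k, m::real, w::real, d::real). s2 + k)"
  define C where "C = (\<lambda>i. A i * B i - (fst (snd i))\<^sup>2)"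
  have A0: "A ?i0 = - (2 * \<beta> * r0 * (s2 + k0))"
    using d0 by (simp add: A_def algebra_simps)
  have "A ?i0 > 0" unfolding A0 using \<beta> r0 K by (simp add: mult_pos_neg mult_neg_pos)
  moreover have "(A \<longlongrightarrow> A ?i0) (nhds ?i0)" "(B \<longlongrightarrow> B ?i0) (nhds ?i0)"
    unfolding A_def B_def case_prod_beta by (intro tendsto_intros filterlim_ident)+
  moreover have "(C \<longlongrightarrow> C ?i0) (nhds ?i0)"
    unfolding C_def by (intro tendsto_intros filterlim_ident calculation(2,3))
  moreover have "C ?i0 > 0"
    using calculation(1) K by (simp add: B_def C_def)
  moreover have "(fst \<longlongrightarrow> r0) (nhds ?i0)"
    using tendsto_fst[OF filterlim_ident, of ?i0] by simp
  ultimately have "\<forall>\<^sub>F i in nhds ?i0. A i > 0 \<and> C i > 0 \<and> fst i < 0"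
    using r0 by (intro eventually_conj) (auto intro: order_tendstoD)
  then show ?thesis
    unfolding isolated_in_fibre_def
  proof (rule eventually_mono, intro impI)
    fix i assume 1: "A i > 0 \<and> C i > 0 \<and> fst i < 0"
      and 2: "syzygies s2 l2 i \<and> energy \<beta> i = energy \<beta> ?i0 \<and> charge \<beta> s2 i = charge \<beta> s2 ?i0"
    obtain r u k m w d where i: "i = (r, u, k, m, w, d)" by (metis surj_pair)
    have rel: "w\<^sup>2 + r\<^sup>2 * s2 + 2 * r * d + k * (1 - r\<^sup>2) - u\<^sup>2 = l2"
      "d\<^sup>2 = s2 * k * (1 - r\<^sup>2) - s2 * u\<^sup>2 - m\<^sup>2 * (1 - r\<^sup>2) + 2 * m * u * w - k * w\<^sup>2"
      "\<beta> * k + r = \<beta> * k0 + r0" "d + s2 * r + \<beta> * m\<^sup>2 = d0 + s2 * r0"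
      using 2 by (simp_all add: i syzygies_def energy_def charge_def)
    have rel0: "r0\<^sup>2 * s2 + 2 * r0 * d0 + k0 * (1 - r0\<^sup>2) = l2" "d0\<^sup>2 = s2 * k0 * (1 - r0\<^sup>2)"
      using syz by (simp_all add: syzygies_def)
    define a b where "a = A i" and "b = B i"
    have pos: "a > 0" "a * b - u\<^sup>2 > 0" "r < 0" using 1 by (simp_all add: i a_def b_def C_def)
    have a: "a = 1 - r\<^sup>2 - 2 * (d0 + s2 * r0) * \<beta> + \<beta>\<^sup>2 * m\<^sup>2" "b = s2 + k"
      by (simp_all add: a_def b_def i A_def B_def)
    define c where "c = d0 + s2 * r0"
    have "c\<^sup>2 = s2 * l2" using syzygies_square[OF syz] by (simp add: c_def)
    moreover note syzygies_square[OF conjunct1[OF 2[unfolded i]]]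
    moreover have "d + s2 * r = c - \<beta> * m\<^sup>2" using rel(4) by (simp add: c_def)
    ultimately have "a * m\<^sup>2 - 2 * m * u * w + b * w\<^sup>2 = 0"
      unfolding a c_def[symmetric] by algebra
    then have "(a * m - u * w)\<^sup>2 + (a * b - u\<^sup>2) * w\<^sup>2 = 0" by algebra
    moreover have "(a * b - u\<^sup>2) * w\<^sup>2 \<ge> 0" using pos by simp
    ultimately have "(a * b - u\<^sup>2) * w\<^sup>2 = 0" "(a * m - u * w)\<^sup>2 = 0"
      using zero_le_power2[of "a * m - u * w"] by linarith+
    then have w: "w = 0" and m: "m = 0" using pos by auto
    have d: "d = d0 + s2 * r0 - s2 * r" and k: "\<beta> * k = \<beta> * k0 + r0 - r"
      and u: "u\<^sup>2 = r\<^sup>2 * s2 + 2 * r * d + k * (1 - r\<^sup>2) - l2"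
      using rel by (simp_all add: w m)
    have "2 * \<beta> * u\<^sup>2 = 2 * \<beta> * r\<^sup>2 * s2 + 4 * r * \<beta> * d + 2 * (\<beta> * k) * (1 - r\<^sup>2) - 2 * \<beta> * l2"
      by (simp add: u algebra_simps)
    \<comment> \<open>The double zero at \<open>r0\<close> reflects the equilibrium condition
      \<open>d0\<close>. The remaining linear factor is negative as long as r < 0.\<close>
    also have "\<dots> = 2 * (r - r0)\<^sup>2 * (r + r0 - \<beta> * (s2 + k0))"
      unfolding k d rel0(1)[symmetric] using d0 by algebra
    finally have u2: "2 * \<beta> * u\<^sup>2 = 2 * (r - r0)\<^sup>2 * (r + r0 - \<beta> * (s2 + k0))" .
    have "\<beta> * (s2 + k0) > 0" using \<beta> K by simp
    then have "r + r0 - \<beta> * (s2 + k0) < 0" using pos r0 by linarith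
    with u2 have r: "r = r0"
      using \<beta> by (smt (verit, best) mult_pos_neg zero_le_mult_iff zero_less_power2 zero_le_power2)
    have "u = 0" using u2 \<beta> by (simp add: r)
    then show "i = ?i0" using rel \<beta> w m r by (simp add: i)
  qed
qed

text \<open>Here the same elimination leaves two equations for \<open>(r, u, m, w)\<close>, whose quadratic parts in
  \<open>(m0\<^sup>2 - m\<^sup>2, r, u, w)\<close> are both indefinite; the sum of the first one and \<open>K / 2\<close> times the
  second one, with \<open>K = s2 + k0\<close>, is definite.\<close>

lemma isolated_horizontal:
  fixes \<beta> s2 l2 k0 m0 d0 :: real
  assumes \<beta>: "\<beta> > 0" and m0: "m0 \<noteq> 0" and K: "s2 + k0 > 0"
    and d0: "2 * \<beta> * d0 = 1"
    and syz: "syzygies s2 l2 (0, 0, k0, m0, 0, d0)"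
  shows "isolated_in_fibre \<beta> s2 l2 (0, 0, k0, m0, 0, d0)"
proof -
  let ?i0 = "(0::real, 0::real, k0, m0, 0::real, d0)"
  define K where "K = s2 + k0"
  \<comment> \<open>\<open>P\<close> is what is left after completing the squares in the definite
    combination below: it is the coefficient of w^2 and, up to the factor K / 2, also that of
    r^2.\<close>
  define P where "P = (\<lambda>(r, u::real, k::real, m, w::real, d::real).
    K\<^sup>2 / 4 - m\<^sup>2 - K * r * d0)"
  \<comment> \<open>The elimination yields only m^2 = m0^2; positivity of \<open>M\<close> then
    fixes the sign.\<close>
  define M where "M = (\<lambda>(r::real, u::real, k::real, m, w::real, d::real). m * m0)"
  have rel0: "k0 = l2" "d0\<^sup>2 = s2 * k0 - m0\<^sup>2"
    using syz by (simp_all add: syzygies_def)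
  have "d0 > 0" using d0 \<beta> by (metis mult_pos_pos zero_less_mult_pos zero_less_numeral zero_less_one)
  then have "d0\<^sup>2 > 0" by simp
  \<comment> \<open>Together with the Gram relation this writes K^2 / 4 - m0^2 as the sum of ((s2 -
    k0) / 2)^2 and d0^2.\<close>
  moreover have "K\<^sup>2 / 4 - s2 * k0 = ((s2 - k0) / 2)\<^sup>2"
    by (simp add: K_def power2_eq_square field_simps)
  ultimately have "K\<^sup>2 / 4 - m0\<^sup>2 > 0"
    using rel0 zero_le_power2[of "(s2 - k0) / 2"] by linarith
  then have "P ?i0 > 0" by (simp add: P_def)
  moreover have "M ?i0 > 0" using m0 by (simp add: M_def flip: power2_eq_square)
  moreover have "(P \<longlongrightarrow> P ?i0) (nhds ?i0)" "(M \<longlongrightarrow> M ?i0) (nhds ?i0)"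
    unfolding P_def M_def case_prod_beta by (intro tendsto_intros filterlim_ident; simp)+
  ultimately have "\<forall>\<^sub>F i in nhds ?i0. P i > 0 \<and> M i > 0"
    by (intro eventually_conj) (auto intro: order_tendstoD)
  then show ?thesis
    unfolding isolated_in_fibre_def
  proof (rule eventually_mono, intro impI)
    fix i assume 1: "P i > 0 \<and> M i > 0"
      and 2: "syzygies s2 l2 i \<and> energy \<beta> i = energy \<beta> ?i0 \<and> charge \<beta> s2 i = charge \<beta> s2 ?i0"
    obtain r u k m w d where i: "i = (r, u, k, m, w, d)" by (metis surj_pair)
    have rel: "w\<^sup>2 + r\<^sup>2 * s2 + 2 * r * d + k * (1 - r\<^sup>2) - u\<^sup>2 = l2"
      "d\<^sup>2 = s2 * k * (1 - r\<^sup>2) - s2 * u\<^sup>2 - m\<^sup>2 * (1 - r\<^sup>2) + 2 * m * u * w - k * w\<^sup>2"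
      "\<beta> * k + r = \<beta> * k0" "d + s2 * r + \<beta> * m\<^sup>2 = d0 + \<beta> * m0\<^sup>2"
      using 2 by (simp_all add: i syzygies_def energy_def charge_def)
    define p where "p = P i"
    have p: "p = K\<^sup>2 / 4 - m\<^sup>2 - K * r * d0" by (simp add: p_def P_def i)
    have pos: "p > 0" "m * m0 > 0" using 1 by (simp_all add: p_def M_def i)
    have K: "K > 0" using K by (simp add: K_def)
    \<comment> \<open>In terms of \<open>y\<close> the charge equation is affine. The condition 2
      \<beta> d0 = 1 then cancels the linear terms, so that \<open>Q1\<close> and \<open>Q2\<close>
      begin with quadratic ones.\<close>
    define y where "y = m0\<^sup>2 - m\<^sup>2"
    have k: "k = k0 - 2 * d0 * r" using rel(3) d0 by algebra
    have d: "d = d0 + \<beta> * y - s2 * r" using rel(4) by (simp add: y_def algebra_simps)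
    have m: "m\<^sup>2 = m0\<^sup>2 - y" by (simp add: y_def)
    have Q1: "\<beta>\<^sup>2 * y\<^sup>2 - m\<^sup>2 * r\<^sup>2 - 2 * m * u * w + (s2 + k) * w\<^sup>2 = 0"
      using syzygies_square[OF syz] syzygies_square[OF conjunct1[OF 2[unfolded i]]] d m d0
      by simp algebra
    have Q2: "u\<^sup>2 - w\<^sup>2 + K * r\<^sup>2 - 2 * \<beta> * r * y - 2 * d0 * r^3 = 0"
      using rel(1) unfolding k d K_def rel0(1)
      by (simp add: algebra_simps power2_eq_square power3_eq_cube)
    have "(K / 2) * (\<beta> * y - K * r / 2)\<^sup>2 + (K / 2) * p * r\<^sup>2 + (K * u / 2 - m * w)\<^sup>2 + p * w\<^sup>2
        = (K / 2) * ((\<beta>\<^sup>2 * y\<^sup>2 - m\<^sup>2 * r\<^sup>2 - 2 * m * u * w + (s2 + k) * w\<^sup>2)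
          + (K / 2) * (u\<^sup>2 - w\<^sup>2 + K * r\<^sup>2 - 2 * \<beta> * r * y - 2 * d0 * r^3))"
      unfolding p k K_def by (simp add: field_simps power2_eq_square power3_eq_cube)
    also have "\<dots> = 0" unfolding Q1 Q2 by simp
    finally have "(K / 2) * (\<beta> * y - K * r / 2)\<^sup>2 + (K / 2) * p * r\<^sup>2 + (K * u / 2 - m * w)\<^sup>2
      + p * w\<^sup>2 = 0" .
    moreover have "(K / 2) * (\<beta> * y - K * r / 2)\<^sup>2 \<ge> 0" "(K / 2) * p * r\<^sup>2 \<ge> 0"
      "(K * u / 2 - m * w)\<^sup>2 \<ge> 0" "p * w\<^sup>2 \<ge> 0" using pos K by simp_all
    ultimately have "(K / 2) * (\<beta> * y - K * r / 2)\<^sup>2 = 0" "(K / 2) * p * r\<^sup>2 = 0"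
      "(K * u / 2 - m * w)\<^sup>2 = 0" "p * w\<^sup>2 = 0" by linarith+
    then have z: "r = 0" "w = 0" "u = 0" "y = 0" using pos K \<beta> by auto
    then have "m\<^sup>2 = m0\<^sup>2" by (simp add: m)
    then have "m = m0" using pos(2) by (auto simp: power2_eq_iff)
    then show "i = ?i0" using z k d by (simp add: i)
  qed
qed

section \<open>Lyapunov stability\<close>

text \<open>The ball bounds k = |D|^2, and S and g have prescribed norms; this bounds R_1 and R_2,
  which are half of S + D and S - D.\<close>

lemma compact_invariant_ball:
  "compact {y \<in> level_set lam rho. dist (reduced_invariants y) i0 \<le> e}" (is "compact ?K")
proof -
  have "level_set lam rho = {y. fst (fst y) = 0 \<and> fst (fst (snd y)) = 0 \<and>
      (reG y)\<^sup>2 + vecG y \<bullet> vecG y = 1 \<and>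
      (sumR y \<bullet> vecG y)\<^sup>2 + (norm (reG y *\<^sub>R sumR y + cross3 (difR y) (vecG y)))\<^sup>2 = (norm lam)\<^sup>2 \<and>
      norm (sumR y) = norm rho}"
    using level_set_iff by blast
  then have "closed (level_set lam rho)"
    by (simp only:) (intro closed_Collect_conj closed_Collect_eq continuous_intros continuous_on_cross)
  then have "closed (level_set lam rho \<inter> {y. dist (reduced_invariants y) i0 \<le> e})"
    by (intro closed_Int closed_Collect_le continuous_intros)
  then have "closed ?K" by (simp add: Int_def)
  moreover have "bounded ?K"
  proof (rule boundedI)
    fix y assume y: "y \<in> ?K"
    then have l: "y \<in> level_set lam rho" by simp
    define M where "M = fst (snd (snd i0)) + e"
    have "dist (difR y \<bullet> difR y) (fst (snd (snd i0))) \<le> e"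
      using y dist_fst_le[of "snd (snd (reduced_invariants y))" "snd (snd i0)"]
        dist_snd_le[of "snd (reduced_invariants y)" "snd i0"] dist_snd_le[of "reduced_invariants y" i0]
      by (simp add: reduced_invariants_def)
    then have "(norm (difR y))\<^sup>2 \<le> M"
      unfolding power2_norm_eq_inner by (simp add: M_def dist_real_def)
    then have D: "norm (difR y) \<le> sqrt M" by (rule real_le_rsqrt)
    have S: "norm (sumR y) = norm rho" and z: "fst (fst y) = 0" "fst (fst (snd y)) = 0"
      using l by (simp_all add: level_set_iff)
    have g: "norm (snd (snd y)) = 1" using l by (auto simp: level_set_def)
    have "2 *\<^sub>R snd (fst y) = sumR y + difR y" "2 *\<^sub>R snd (fst (snd y)) = sumR y - difR y"
      by (simp_all add: sumR_def difR_def scaleR_2)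
    then have "2 * norm (snd (fst y)) = norm (sumR y + difR y)"
      "2 * norm (snd (fst (snd y))) = norm (sumR y - difR y)"
      by (metis norm_scaleR abs_numeral)+
    moreover have "norm (fst y) = norm (snd (fst y))" "norm (fst (snd y)) = norm (snd (fst (snd y)))"
      using z by (simp_all add: norm_prod_def)
    ultimately have "norm (fst y) + norm (fst (snd y)) \<le> norm rho + sqrt M"
      using D S norm_triangle_ineq[of "sumR y" "difR y"] norm_triangle_ineq4[of "sumR y" "difR y"]
      by linarith
    then show "norm y \<le> norm rho + sqrt M + 1"
      using norm_Pair_le[of "fst y" "snd y"] norm_Pair_le[of "fst (snd y)" "snd (snd y)"] g by simp
  qed
  ultimately show ?thesis by (simp add: compact_eq_bounded_closed)
qed

lemma conserved_along_trajectory: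
  assumes \<beta>: "\<beta> = \<alpha> / (4 * \<gamma>)" and \<gamma>: "\<gamma> > 0" and J: "convex J" "t \<in> J" "t' \<in> J"
    and c: "\<And>t. t \<in> J \<Longrightarrow> c t \<in> level_set lam rho"
      "\<And>t. t \<in> J \<Longrightarrow> (c has_vector_derivative top_field \<alpha> \<gamma> (c t)) (at t within J)"
  shows "energy \<beta> (reduced_invariants (c t)) = energy \<beta> (reduced_invariants (c t'))"
    and "charge \<beta> ((norm rho)\<^sup>2) (reduced_invariants (c t))
      = charge \<beta> ((norm rho)\<^sup>2) (reduced_invariants (c t'))"
proof -
  have "((\<lambda>t. energy \<beta> (reduced_invariants (c t))) has_vector_derivative 0) (at t within J) \<and>
    ((\<lambda>t. charge \<beta> ((norm rho)\<^sup>2) (reduced_invariants (c t))) has_vector_derivative 0) (at t within J)"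
    if t: "t \<in> J" for t
  proof -
    obtain r u k m w d where i: "reduced_invariants (c t) = (r, u, k, m, w, d)" by (metis surj_pair)
    note eqs = reduced_equations[OF c(2)[OF t] c(1)[OF t] i]
    have m: "sumR (c t) \<bullet> difR (c t) = m" using i by (simp add: reduced_invariants_def)
    have "((\<lambda>t. energy \<beta> (reduced_invariants (c t))) has_vector_derivative
        \<beta> * (- 4 * \<gamma> * u) + \<alpha> * u) (at t within J)"
      unfolding energy_def reduced_invariants_def case_prod_conv
      by (intro has_vector_derivative_add has_vector_derivative_mult_right eqs)
    moreover have "\<beta> * (- 4 * \<gamma> * u) + \<alpha> * u = 0"
      using \<gamma> by (simp add: \<beta>)
    moreover have "((\<lambda>t. charge \<beta> ((norm rho)\<^sup>2) (reduced_invariants (c t))) has_vector_derivative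
        \<alpha> * (m * w - (norm rho)\<^sup>2 * u) + (norm rho)\<^sup>2 * (\<alpha> * u)
        + \<beta> * (sumR (c t) \<bullet> difR (c t) * (- 2 * \<gamma> * w) + - 2 * \<gamma> * w * (sumR (c t) \<bullet> difR (c t))))
        (at t within J)"
      unfolding charge_def reduced_invariants_def case_prod_conv power2_eq_square[of "_ \<bullet> _"]
      by (intro has_vector_derivative_add has_vector_derivative_mult_right has_vector_derivative_mult eqs)
    moreover have "\<alpha> * (m * w - (norm rho)\<^sup>2 * u) + (norm rho)\<^sup>2 * (\<alpha> * u)
        + \<beta> * (m * (- 2 * \<gamma> * w) + - 2 * \<gamma> * w * m) = 0"
      using \<gamma> by (simp add: \<beta> field_simps)
    ultimately show ?thesis by (simp only: m)
  qed
  then have const: "\<And>t. t \<in> J \<Longrightarrow>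
      ((\<lambda>t. energy \<beta> (reduced_invariants (c t))) has_vector_derivative 0) (at t within J)"
    "\<And>t. t \<in> J \<Longrightarrow>
      ((\<lambda>t. charge \<beta> ((norm rho)\<^sup>2) (reduced_invariants (c t))) has_vector_derivative 0) (at t within J)"
    by blast+
  show "energy \<beta> (reduced_invariants (c t)) = energy \<beta> (reduced_invariants (c t'))"
    using has_vector_derivative_zero_constant[OF J(1) const(1)] J(2,3) by metis
  show "charge \<beta> ((norm rho)\<^sup>2) (reduced_invariants (c t))
      = charge \<beta> ((norm rho)\<^sup>2) (reduced_invariants (c t'))"
    using has_vector_derivative_zero_constant[OF J(1) const(2)] J(2,3) by metis
qed

text \<open>In the proof \<phi> is the distance of the invariants and \<psi> the deviation of the
  conserved quantities. The compact set \<open>C\<close> consists of the points of the ball that lie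
  outside the given neighbourhood or on the sphere \<phi> = e. By isolation \<psi> has a positive
  lower bound \<delta> on \<open>C\<close>. A trajectory starting with \<phi> < e and \<psi> <
  \<delta> keeps its \<psi>, so it never meets \<open>C\<close>; by the intermediate value theorem
  it cannot leave the ball either.\<close>

lemma lyapunov_stable_if_isolated:
  assumes \<beta>: "\<beta> = \<alpha> / (4 * \<gamma>)" and \<gamma>: "\<gamma> > 0" and x: "x \<in> level_set lam rho" and e: "e > 0"
    and iso: "\<And>y. \<lbrakk>y \<in> level_set lam rho; dist (reduced_invariants y) (reduced_invariants x) \<le> e;
        energy \<beta> (reduced_invariants y) = energy \<beta> (reduced_invariants x);
        charge \<beta> ((norm rho)\<^sup>2) (reduced_invariants y) = charge \<beta> ((norm rho)\<^sup>2) (reduced_invariants x)\<rbrakk>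
      \<Longrightarrow> orbit y = orbit x"
  shows "lyapunov_stable \<alpha> \<gamma> lam rho (orbit x)"
  unfolding lyapunov_stable_def
proof (intro allI impI, elim conjE)
  fix U assume U: "openin (reduced_topology lam rho) U" and xU: "orbit x \<in> U"
  let ?L = "level_set lam rho" and ?i = reduced_invariants
  define \<phi> where "\<phi> = (\<lambda>y. dist (?i y) (?i x))"
  define \<psi> where "\<psi> = (\<lambda>y. \<bar>energy \<beta> (?i y) - energy \<beta> (?i x)\<bar>
    + \<bar>charge \<beta> ((norm rho)\<^sup>2) (?i y) - charge \<beta> ((norm rho)\<^sup>2) (?i x)\<bar>)"
  have cont: "continuous_on A \<phi>" "continuous_on A \<psi>" for A
    unfolding \<phi>_def \<psi>_def energy_def charge_def case_prod_beta by (intro continuous_intros)+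
  have inv: "\<phi> y = \<phi> z" "\<psi> y = \<psi> z" if "orbit y = orbit z" for y z
    using reduced_invariants_orbit[OF that] by (simp_all add: \<phi>_def \<psi>_def)
  define W where "W = {y \<in> ?L. orbit y \<in> U}"
  have "openin (top_of_set ?L) W"
    using U by (simp add: openin_reduced_topology W_def)
  then obtain W' where W': "open W'" "W = ?L \<inter> W'" by (auto simp: openin_open)
  define C where "C = {y \<in> ?L. \<phi> y \<le> e} \<inter> (- W' \<union> {y. \<phi> y = e})"
  have "compact C" unfolding C_def
    using W' compact_invariant_ball[of lam rho "?i x" e]
    by (intro compact_Int_closed closed_Un closed_Collect_eq cont continuous_intros)
      (simp_all add: \<phi>_def)
  have pos: "\<psi> y > 0" if "y \<in> C" for y
  proof (rule ccontr)
    assume "\<not> \<psi> y > 0"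
    then have "\<psi> y = 0" by (simp add: \<psi>_def)
    then have "orbit y = orbit x"
      using that by (intro iso) (auto simp: C_def \<psi>_def \<phi>_def)
    then have "y \<in> W" "\<phi> y = 0" using xU that inv[of y x] by (auto simp: W_def C_def \<phi>_def)
    then show False using that e W' by (auto simp: C_def)
  qed
  obtain \<delta> where \<delta>: "\<delta> > 0" "\<And>y. y \<in> C \<Longrightarrow> \<psi> y \<ge> \<delta>"
  proof (cases "C = {}")
    case False
    then obtain z where "z \<in> C" "\<And>y. y \<in> C \<Longrightarrow> \<psi> z \<le> \<psi> y"
      using continuous_attains_inf[OF \<open>compact C\<close> _ cont(2)] by blast
    then show ?thesis using pos that by blast
  qed (use that[of 1] in auto)
  define N where "N = {y \<in> ?L. \<phi> y < e \<and> \<psi> y < \<delta>}"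
  have "N = ?L \<inter> {y. \<phi> y < e \<and> \<psi> y < \<delta>}" by (auto simp: N_def)
  moreover have "open {y. \<phi> y < e \<and> \<psi> y < \<delta>}"
    by (intro open_Collect_conj open_Collect_less cont continuous_intros)
  ultimately have "openin (top_of_set ?L) N" by (auto simp: openin_open)
  \<comment> \<open>\<open>N\<close> is a union of orbits within the level set, so its image is open
    in the quotient topology.\<close>
  moreover have NV: "{y \<in> ?L. orbit y \<in> orbit ` N} = N"
  proof (intro set_eqI iffI)
    fix y assume "y \<in> {y \<in> ?L. orbit y \<in> orbit ` N}"
    then obtain z where "y \<in> ?L" "z \<in> N" "orbit y = orbit z" by blast
    then show "y \<in> N" using inv[of y z] by (simp add: N_def)
  qed (simp add: N_def)
  moreover have "orbit ` N \<subseteq> full_reduced_space lam rho"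
    by (auto simp: N_def full_reduced_space_def)
  ultimately have "openin (reduced_topology lam rho) (orbit ` N)"
    by (simp add: openin_reduced_topology)
  moreover have "orbit x \<in> orbit ` N"
    using x e \<delta> by (auto simp: N_def \<phi>_def \<psi>_def)
  moreover have "\<Gamma> T \<in> U"
    if T: "T \<ge> 0" and \<Gamma>: "reduced_trajectory \<alpha> \<gamma> lam rho {0..T} \<Gamma>" "\<Gamma> 0 \<in> orbit ` N" for T \<Gamma>
  proof -
    obtain c where c: "\<And>t. t \<in> {0..T} \<Longrightarrow> c t \<in> ?L" "\<And>t. t \<in> {0..T} \<Longrightarrow> \<Gamma> t = orbit (c t)"
      "\<And>t. t \<in> {0..T} \<Longrightarrow> (c has_vector_derivative top_field \<alpha> \<gamma> (c t)) (at t within {0..T})"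
      using \<Gamma>(1) unfolding reduced_trajectory_def by blast
    have c0: "c 0 \<in> N" using \<Gamma>(2) c(1,2)[of 0] T NV by auto
    have \<psi>: "\<psi> (c t) < \<delta>" if "t \<in> {0..T}" for t
      using conserved_along_trajectory[OF \<beta> \<gamma> _ that _ c(1,3), of 0] T c0
      by (simp add: \<psi>_def N_def)
    have "continuous_on {0..T} c"
      using c(3) by (meson continuous_on_eq_continuous_within has_vector_derivative_continuous)
    then have ct: "continuous_on {0..T} (\<lambda>t. \<phi> (c t))"
      by (rule continuous_on_compose2[OF cont(1)[of UNIV]]) simp
    have "\<phi> (c T) < e"
    proof (rule ccontr)
      assume "\<not> \<phi> (c T) < e"
      then obtain t where t: "0 \<le> t" "t \<le> T" "\<phi> (c t) = e"
        using IVT'[OF _ _ T ct, of e] c0 by (auto simp: N_def)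
      then have "c t \<in> C" using c(1) by (auto simp: C_def)
      then show False using \<delta>(2) \<psi>[of t] t by fastforce
    qed
    moreover have "c T \<notin> C" using \<delta>(2) \<psi>[of T] T by fastforce
    ultimately have "c T \<in> W" using c(1)[of T] T W' by (auto simp: C_def)
    then show ?thesis using c(2)[of T] T by (simp add: W_def)
  qed
  ultimately show "\<exists>V. openin (reduced_topology lam rho) V \<and> orbit x \<in> V \<and>
      (\<forall>T\<ge>0. \<forall>\<Gamma>. reduced_trajectory \<alpha> \<gamma> lam rho {0..T} \<Gamma> \<and> \<Gamma> 0 \<in> V \<longrightarrow> \<Gamma> T \<in> U)"
    by blast
qed

section \<open>Equilibrium conditions and the stable cases\<close>

lemma relative_equilibrium_equations:
  assumes "relative_equilibrium \<alpha> \<gamma> lam rho (orbit x)" "\<alpha> > 0" "\<gamma> > 0"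
    and i: "reduced_invariants x = (r, u, k, m, w, d)"
  shows "u = 0" "w = 0" "r * m = 0" "2 * \<gamma> * (1 - r\<^sup>2) = \<alpha> * (d - r * k)"
proof -
  obtain c where c: "\<And>t. c t \<in> level_set lam rho" "\<And>t. orbit x = orbit (c t)"
    "\<And>t. (c has_vector_derivative top_field \<alpha> \<gamma> (c t)) (at t)"
    using assms(1) unfolding relative_equilibrium_def reduced_trajectory_def by auto
  have ic: "reduced_invariants (c t) = (r, u, k, m, w, d)" for t
    using reduced_invariants_orbit[OF c(2)[of t]] i by simp
  then have const: "reG (c t) = r" "difR (c t) \<bullet> vecG (c t) = u" "sumR (c t) \<bullet> difR (c t) = m"
    "sumR (c t) \<bullet> vecG (c t) = w" for t
    by (simp_all add: reduced_invariants_def)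
  note eqs = reduced_equations[OF c(3)[of 0] c(1) ic]
  \<comment> \<open>The lifted curve may move along its orbit, but the invariants stay constant, so
    the right-hand sides of the reduced equations vanish.\<close>
  have "\<alpha> * u = 0"
    using eqs(1) unfolding const by (rule vector_derivative_unique_at) (rule has_vector_derivative_const)
  moreover have "- 2 * \<gamma> * (1 - r\<^sup>2) + \<alpha> * (d - r * k) = 0"
    using eqs(2) unfolding const by (rule vector_derivative_unique_at) (rule has_vector_derivative_const)
  moreover have "- 2 * \<gamma> * w = 0"
    using eqs(4) unfolding const by (rule vector_derivative_unique_at) (rule has_vector_derivative_const)
  moreover have "- \<alpha> * r * m = 0"
    using eqs(5) unfolding const by (rule vector_derivative_unique_at) (rule has_vector_derivative_const)
  ultimately show "u = 0" "w = 0" "r * m = 0" "2 * \<gamma> * (1 - r\<^sup>2) = \<alpha> * (d - r * k)"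
    using assms(2,3) by auto
qed

lemma isolated_in_fibreD:
  assumes "isolated_in_fibre \<beta> s2 l2 i0"
  shows "\<exists>e>0. \<forall>i. dist i i0 \<le> e \<and> syzygies s2 l2 i \<and>
     energy \<beta> i = energy \<beta> i0 \<and> charge \<beta> s2 i = charge \<beta> s2 i0 \<longrightarrow> i = i0"
proof -
  obtain e where "e > 0" "\<And>i. dist i i0 < e \<Longrightarrow> syzygies s2 l2 i \<and>
     energy \<beta> i = energy \<beta> i0 \<and> charge \<beta> s2 i = charge \<beta> s2 i0 \<longrightarrow> i = i0"
    using assms unfolding isolated_in_fibre_def eventually_nhds_metric by blast
  then show ?thesis by (intro exI[of _ "e / 2"]) auto
qed

lemma hanging_or_horizontal_stable:
  assumes \<alpha>: "\<alpha> > 0" and \<gamma>: "\<gamma> > 0" and x: "x \<in> level_set lam rho"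
    and re: "relative_equilibrium \<alpha> \<gamma> lam rho (orbit x)"
    and h: "reG x < 0 \<or> reG x = 0 \<and> sumR x \<bullet> difR x \<noteq> 0"
  shows "lyapunov_stable \<alpha> \<gamma> lam rho (orbit x)"
proof -
  define \<beta> where "\<beta> = \<alpha> / (4 * \<gamma>)"
  have \<beta>: "\<beta> > 0" using \<alpha> \<gamma> by (simp add: \<beta>_def)
  obtain r u k m w d where i: "reduced_invariants x = (r, u, k, m, w, d)" by (metis surj_pair)
  note eqs = relative_equilibrium_equations[OF re \<alpha> \<gamma> i]
  have ri: "reG x = r" "difR x \<bullet> difR x = k" "sumR x \<bullet> difR x = m"
    "sumR x \<bullet> cross3 (difR x) (vecG x) = d"
    using i by (simp_all add: reduced_invariants_def)
  define s2 l2 where "s2 = (norm rho)\<^sup>2" and "l2 = (norm lam)\<^sup>2"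
  have syz: "syzygies s2 l2 (r, 0, k, m, 0, d)"
    using level_set_syzygies[OF x] i eqs by (simp add: s2_def l2_def)
  have i: "reduced_invariants x = (r, 0, k, m, 0, d)" using i eqs by simp
  have k0: "k \<ge> 0" using ri by (metis inner_ge_zero)
  have s0: "s2 \<ge> 0" by (simp add: s2_def)
  have e4: "2 * \<beta> * d = 2 * \<beta> * r * k + (1 - r\<^sup>2)"
    using eqs(4) \<gamma> by (simp add: \<beta>_def field_simps)
  show ?thesis
  proof (cases "k = 0")
    case True
    then have "d\<^sup>2 = - (m\<^sup>2 * (1 - r\<^sup>2))" using syz by (simp add: syzygies_def)
    moreover have "m\<^sup>2 * (1 - r\<^sup>2) \<ge> 0"
      using level_set_inner(1)[OF x] ri(1) by (metis inner_ge_zero mult_nonneg_nonneg zero_le_power2)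
    ultimately have "d\<^sup>2 \<le> 0" by linarith
    then have "d = 0" by simp
    then have r2: "r\<^sup>2 = 1" using e4 True by simp
    then have r: "r = - 1" using h ri by (auto simp: power2_eq_1_iff)
    have x0: "difR x = 0" "vecG x = 0" using ri level_set_inner(1)[OF x] r2 True by simp_all
    show ?thesis
    proof (rule lyapunov_stable_if_isolated[OF \<beta>_def \<gamma> x zero_less_one])
      fix y assume y: "y \<in> level_set lam rho"
        and en: "energy \<beta> (reduced_invariants y) = energy \<beta> (reduced_invariants x)"
      have "\<beta> * (difR y \<bullet> difR y) + reG y = - 1"
        using en by (simp only: i energy_def True r) (simp add: reduced_invariants_def)
      moreover have "\<beta> * (difR y \<bullet> difR y) \<ge> 0" using \<beta> by simp
      moreover have "(reG y)\<^sup>2 \<le> 1"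
        using level_set_inner(1)[OF y] by (metis diff_ge_0_iff_ge inner_ge_zero)
      then have "reG y \<ge> - 1" by (simp add: abs_square_le_1)
      ultimately have "reG y = - 1" "\<beta> * (difR y \<bullet> difR y) = 0" by linarith+
      then have y0: "reG y = reG x" "difR y = 0" "vecG y = 0"
        using level_set_inner(1)[OF y] \<beta> r ri by auto
      obtain s where s: "norm s = 1" "rot s (sumR x) = sumR y"
        using rot_pair_exists[of "sumR x" "sumR y" 0 0] level_set_inner(2)[OF x]
          level_set_inner(2)[OF y] by auto
      then have "conj_act s x = y"
        using y level_set_conj_act[OF s(1) x] unfolding level_set_iff
        by (intro state_eqI) (simp_all add: conj_act_components x0 y0 rot_simps)
      then show "orbit y = orbit x" using orbit_conj_act[OF s(1)] by metis
    qed
  next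
    case False
    then have K: "s2 + k > 0" and k: "k > 0" using s0 k0 by auto
    \<comment> \<open>At r^2 = 1 one has d = 0, and the equilibrium condition then gives k =
      0.\<close>
    have r1: "r\<^sup>2 \<noteq> 1"
    proof
      assume r2: "r\<^sup>2 = 1"
      then have "d = 0" using syz by (simp add: syzygies_def)
      then show False using e4 r2 False \<beta> by auto
    qed
    have nz: "cross3 (difR x) (vecG x) \<noteq> 0"
      using norm_cross_dot[of "difR x" "vecG x"] k r1 ri i level_set_inner(1)[OF x]
      by (auto simp: power_mult_distrib power2_norm_eq_inner reduced_invariants_def)
    have "isolated_in_fibre \<beta> s2 l2 (reduced_invariants x)"
    proof (cases "r < 0")
      case True
      then have "m = 0" using eqs(3) by simp
      then show ?thesis using isolated_hanging[OF \<beta> True K e4] syz i by simp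
    next
      case False
      then have r: "r = 0" "m \<noteq> 0" using h ri by auto
      then show ?thesis using isolated_horizontal[OF \<beta> r(2) K] e4 syz i by simp
    qed
    then obtain e where e: "e > 0" "\<And>i. \<lbrakk>dist i (reduced_invariants x) \<le> e; syzygies s2 l2 i;
        energy \<beta> i = energy \<beta> (reduced_invariants x);
        charge \<beta> s2 i = charge \<beta> s2 (reduced_invariants x)\<rbrakk> \<Longrightarrow> i = reduced_invariants x"
      using isolated_in_fibreD by metis
    show ?thesis
    proof (rule lyapunov_stable_if_isolated[OF \<beta>_def \<gamma> x e(1)])
      fix y assume "y \<in> level_set lam rho" "dist (reduced_invariants y) (reduced_invariants x) \<le> e"
        "energy \<beta> (reduced_invariants y) = energy \<beta> (reduced_invariants x)"
        "charge \<beta> ((norm rho)\<^sup>2) (reduced_invariants y) = charge \<beta> ((norm rho)\<^sup>2) (reduced_invariants x)"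
      then show "orbit y = orbit x"
        using e(2)[of "reduced_invariants y"] level_set_syzygies[of y lam rho]
        by (intro separation[OF x _ _ nz]) (simp_all add: s2_def l2_def)
    qed
  qed
qed

section \<open>Linear instability\<close>

lemma smooth_const: "smooth (\<lambda>x. c)"
proof (coinduction arbitrary: c)
  case smooth
  show ?case by (intro exI[of _ "\<lambda>x. c"]) (auto simp: frechet_derivative_const)
qed

lemma smooth_linear:
  assumes "bounded_linear f"
  shows "smooth f"
proof (rule smooth.intros)
  fix x
  show "f differentiable at x" using assms by (rule bounded_linear_imp_differentiable)
  have "frechet_derivative f (at y) = f" for y
    using frechet_derivative_at[OF bounded_linear_imp_has_derivative[OF assms]] by simp
  then show "smooth (\<lambda>x. frechet_derivative f (at x) v)" for v
    by (simp add: smooth_const)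
qed

lemma smooth_inner:
  fixes f g :: "'a::euclidean_space \<Rightarrow> 'b::real_inner"
  assumes "bounded_linear f" "bounded_linear g"
  shows "smooth (\<lambda>x. f x \<bullet> g x)"
proof (rule smooth.intros)
  have d: "((\<lambda>x. f x \<bullet> g x) has_derivative (\<lambda>v. f x \<bullet> g v + f v \<bullet> g x)) (at x)" for x
    by (intro has_derivative_inner bounded_linear_imp_has_derivative assms)
  show "(\<lambda>x. f x \<bullet> g x) differentiable at x" for x
    using d by (auto simp: differentiable_def)
  have "bounded_linear (\<lambda>x. f x \<bullet> g v + f v \<bullet> g x)" for v
    using assms by (intro bounded_linear_add bounded_linear_inner_right_comp
        bounded_linear_inner_left_comp)
  then show "smooth (\<lambda>x. frechet_derivative (\<lambda>x. f x \<bullet> g x) (at x) v)" for v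
    unfolding frechet_derivative_at[OF d, symmetric] by (rule smooth_linear)
qed

lemma smooth_differentiable: "smooth f \<Longrightarrow> f differentiable (at x)"
  by (erule smooth.cases) auto

lemma smooth_frechet_derivative: "smooth f \<Longrightarrow> smooth (\<lambda>x. frechet_derivative f (at x) v)"
  by (erule smooth.cases) auto

lemma smooth_tendsto:
  assumes "smooth f" "(\<xi> \<longlongrightarrow> x) F"
  shows "((\<lambda>t. f (\<xi> t)) \<longlongrightarrow> f x) F"
  by (rule isCont_tendsto_compose[OF
        differentiable_imp_continuous_within[OF smooth_differentiable[OF assms(1)]] assms(2)])

text \<open>Smoothness speaks about the derivative in each fixed direction. Expanding the direction
  in the basis turns this into joint continuity in base point and direction.\<close>

lemma tendsto_frechet_derivative:
  assumes f: "smooth f" and \<xi>: "(\<xi> \<longlongrightarrow> x) F" and w: "(w \<longlongrightarrow> w0) F"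
  shows "((\<lambda>t. frechet_derivative f (at (\<xi> t)) (w t)) \<longlongrightarrow> frechet_derivative f (at x) w0) F"
proof -
  have eq: "frechet_derivative f (at y) v = (\<Sum>b\<in>Basis. (v \<bullet> b) * frechet_derivative f (at y) b)" for y v
  proof -
    have l: "linear (frechet_derivative f (at y))"
      by (rule linear_frechet_derivative[OF smooth_differentiable[OF f]])
    have "frechet_derivative f (at y) (\<Sum>b\<in>Basis. (v \<bullet> b) *\<^sub>R b)
        = (\<Sum>b\<in>Basis. (v \<bullet> b) * frechet_derivative f (at y) b)"
      by (simp only: linear_sum[OF l] linear_scale[OF l] real_scaleR_def)
    then show ?thesis by (simp only: euclidean_representation)
  qed
  show ?thesis unfolding eq[of _ "w _"] eq[of _ w0]
    by (rule tendsto_sum, rule tendsto_mult[OF tendsto_inner[OF w tendsto_const]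
          smooth_tendsto[OF smooth_frechet_derivative[OF f] \<xi>]])
qed

lemma smooth_chain:
  assumes "smooth f" "(\<xi> has_vector_derivative \<xi>') (at t)"
  shows "((\<lambda>t. f (\<xi> t)) has_real_derivative frechet_derivative f (at (\<xi> t)) \<xi>') (at t)"
proof -
  have d: "(f has_derivative frechet_derivative f (at (\<xi> t))) (at (\<xi> t))"
    using smooth_differentiable[OF assms(1)] frechet_derivative_works by blast
  have "((f \<circ> \<xi>) has_derivative (frechet_derivative f (at (\<xi> t)) \<circ> (\<lambda>s. s *\<^sub>R \<xi>'))) (at t)"
    using assms(2) d unfolding has_vector_derivative_def by (rule diff_chain_at)
  then show ?thesis
    unfolding has_field_derivative_def
    by (simp add: o_def linear_scale[OF has_derivative_linear[OF d]] mult.commute[of _ "frechet_derivative f (at (\<xi> t)) \<xi>'"])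
qed

section \<open>States in the coordinates S, D, G, r, and infinitesimal rotations\<close>

definition state_of :: "real ^ 3 \<Rightarrow> real ^ 3 \<Rightarrow> real ^ 3 \<Rightarrow> real \<Rightarrow> state" where
  "state_of S D G r = ((0, (1/2) *\<^sub>R (S + D)), (0, (1/2) *\<^sub>R (S - D)), (r, G))"

lemma state_of_components [simp]:
  "fst (fst (state_of S D G r)) = 0" "fst (fst (snd (state_of S D G r))) = 0"
  "sumR (state_of S D G r) = S" "difR (state_of S D G r) = D"
  "vecG (state_of S D G r) = G" "reG (state_of S D G r) = r"
  by (simp_all add: state_of_def sumR_def difR_def vecG_def reG_def algebra_simps
      vec_eq_iff)

lemma state_of_level_set:
  "x \<in> level_set lam rho \<Longrightarrow> x = state_of (sumR x) (difR x) (vecG x) (reG x)"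
  by (intro state_eqI) (simp_all add: level_set_iff)

lemma state_of_arith:
  "state_of S D G r + state_of S' D' G' r' = state_of (S + S') (D + D') (G + G') (r + r')"
  "state_of S D G r - state_of S' D' G' r' = state_of (S - S') (D - D') (G - G') (r - r')"
  "c *\<^sub>R state_of S D G r = state_of (c *\<^sub>R S) (c *\<^sub>R D) (c *\<^sub>R G) (c * r)"
  by (simp_all add: state_of_def algebra_simps)

lemma bounded_linear_state_of: "bounded_linear (\<lambda>(S, D, G, r). state_of S D G r)"
  by (simp add: linear_conv_bounded_linear[symmetric] linear_iff state_of_arith case_prod_beta)

lemma has_vector_derivative_state_of:
  assumes "(S has_vector_derivative S') (at t within A)" "(D has_vector_derivative D') (at t within A)"
    "(G has_vector_derivative G') (at t within A)" "(r has_vector_derivative r') (at t within A)"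
  shows "((\<lambda>t. state_of (S t) (D t) (G t) (r t)) has_vector_derivative state_of S' D' G' r') (at t within A)"
  using bounded_linear.has_vector_derivative[OF bounded_linear_state_of
      has_vector_derivative_Pair[OF assms(1) has_vector_derivative_Pair[OF assms(2)
          has_vector_derivative_Pair[OF assms(3,4)]]]] by simp

lemma tendsto_state_of:
  assumes "(S \<longlongrightarrow> S') F" "(D \<longlongrightarrow> D') F" "(G \<longlongrightarrow> G') F" "(r \<longlongrightarrow> r') F"
  shows "((\<lambda>t. state_of (S t) (D t) (G t) (r t)) \<longlongrightarrow> state_of S' D' G' r') F"
  unfolding state_of_def by (intro tendsto_intros assms)

lemma top_field_state_of:
  "top_field \<alpha> \<gamma> (state_of S D G r)
    = state_of 0 ((- 2 * \<gamma>) *\<^sub>R G) (\<alpha> *\<^sub>R (- r *\<^sub>R D + cross3 G S)) (\<alpha> * (D \<bullet> G))"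
  by (simp add: state_of_def top_field_def im_part_def qmult_def inner_simps inner_commute
      cross_add_right cross_skew[of _ G] cross_mult_left cross_mult_right
      Cross3.left_diff_distrib Cross3.right_diff_distrib vec_eq_iff algebra_simps)

definition inf_rot :: "real ^ 3 \<Rightarrow> state \<Rightarrow> state" where
  "inf_rot h y = ((0, cross3 h (snd (fst y))), (0, cross3 h (snd (fst (snd y)))), (0, cross3 h (vecG y)))"

lemma inf_rot_state_of: "inf_rot h (state_of S D G r) = state_of (cross3 h S) (cross3 h D) (cross3 h G) 0"
  by (simp add: inf_rot_def state_of_def vecG_def cross_mult_right cross_add_right
      Cross3.right_diff_distrib)

text \<open>An invariant function is constant along the conjugates of \<open>y\<close> by cos t + n
  sin t. These rotate through the angle 2 t, hence the factor 2 that has to be divided out.\<close>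

lemma invariant_inf_rot:
  assumes "f \<in> invariant_functions"
  shows "frechet_derivative f (at y) (inf_rot h y) = 0"
proof (cases "h = 0")
  case True
  then have "inf_rot h y = 0" by (simp add: inf_rot_def zero_prod_def)
  then show ?thesis
    using linear_0[OF linear_frechet_derivative[OF smooth_differentiable]] assms
    by (auto simp: invariant_functions_def)
next
  case False
  have f: "smooth f" "\<And>s z. norm s = 1 \<Longrightarrow> f (conj_act s z) = f z"
    using assms by (auto simp: invariant_functions_def)
  define n where "n = h /\<^sub>R norm h"
  have n: "norm n = 1" "h = norm h *\<^sub>R n" using False by (simp_all add: n_def)
  define s where "s = (\<lambda>t. (cos t, sin t *\<^sub>R n))"
  have s: "norm (s t) = 1" for t
    using n(1) by (simp add: s_def norm_prod_def)
  obtain a A b B c G where y: "y = ((a, A), (b, B), (c, G))" by (metis surj_pair)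
  have rot: "((\<lambda>t. rot (s t) v) has_vector_derivative 2 *\<^sub>R cross3 n v) (at 0)" for v
  proof -
    have "rot (s t) v = (cos t ^ 2 - sin t ^ 2) *\<^sub>R v + (2 * (sin t)\<^sup>2 * (n \<bullet> v)) *\<^sub>R n
        + (2 * cos t * sin t) *\<^sub>R cross3 n v" for t
      using n(1) by (simp add: rot_def s_def power2_eq_square cross_mult_left dot_square_norm)
    then show ?thesis
      by (auto intro!: derivative_eq_intros)
  qed
  have "((\<lambda>t. conj_act (s t) y) has_vector_derivative 2 *\<^sub>R inf_rot n y) (at 0)"
    unfolding y conj_act_rot[OF s]
    by (auto simp: inf_rot_def vecG_def intro!: has_vector_derivative_Pair rot)
  from smooth_chain[OF f(1) this]
  have "((\<lambda>t. f y) has_real_derivative frechet_derivative f (at (conj_act (s 0) y)) (2 *\<^sub>R inf_rot n y)) (at 0)"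
    by (simp add: f(2)[OF s])
  moreover have "conj_act (s 0) y = y"
    by (simp add: y conj_act_rot[OF s]) (simp add: rot_def s_def)
  ultimately have "frechet_derivative f (at y) (2 *\<^sub>R inf_rot n y) = 0"
    using DERIV_unique DERIV_const by metis
  moreover have "inf_rot h y = (norm h / 2) *\<^sub>R (2 *\<^sub>R inf_rot n y)"
    by (subst n(2)) (simp add: inf_rot_def cross_mult_left)
  ultimately show ?thesis
    using linear_scale[OF linear_frechet_derivative[OF smooth_differentiable[OF f(1)]]] by simp
qed

lemma right_difference_quotient:
  assumes "(c has_vector_derivative c') (at 0)"
  shows "((\<lambda>t. (c t - c 0) /\<^sub>R t) \<longlongrightarrow> c') (at_right 0)"
proof -
  have "((\<lambda>t. ((c t - c 0) - t *\<^sub>R c') /\<^sub>R norm t) \<longlongrightarrow> 0) (at_right 0)"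
    using has_vector_derivative_at_within[OF assms, of "{0<..}"]
    by (simp add: has_vector_derivative_def has_derivative_at_within)
  from tendsto_add[OF this tendsto_const[of c']]
  have "((\<lambda>t. ((c t - c 0) - t *\<^sub>R c') /\<^sub>R norm t + c') \<longlongrightarrow> c') (at_right 0)" by simp
  then show ?thesis
    by (rule Lim_transform_eventually) (auto simp: eventually_at_filter scaleR_diff_right)
qed

text \<open>The tangent vector is the limit of the difference quotients along a curve \<open>\<xi>\<close> in the level
  set. At the singular point \<open>r = 1\<close>, \<open>S = D = G = 0\<close> the right scale is \<open>q t = t\<^sup>2\<close>.\<close>

lemma linearly_unstable_if_curve:
  assumes x: "x \<in> level_set lam rho"
    and \<xi>: "\<forall>\<^sub>F t in at_right 0. \<xi> t \<in> level_set lam rho" "(\<xi> \<longlongrightarrow> x) (at_right (0::real))"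
    and q: "\<And>f. f \<in> invariant_functions \<Longrightarrow>
      \<exists>l. ((\<lambda>t. (f (\<xi> t) - f x) / q t) \<longlongrightarrow> l) (at_right 0) \<and>
        ((\<lambda>t. (flow_derivative \<alpha> \<gamma> f (\<xi> t) - flow_derivative \<alpha> \<gamma> f x) / q t) \<longlongrightarrow> \<mu> * l) (at_right 0)"
    and f0: "f0 \<in> invariant_functions" "((\<lambda>t. (f0 (\<xi> t) - f0 x) / q t) \<longlongrightarrow> l0) (at_right 0)" "l0 \<noteq> 0"
    and \<mu>: "\<mu> \<noteq> 0"
  shows "linearly_unstable \<alpha> \<gamma> lam rho x"
proof -
  \<comment> \<open>\<open>Lim\<close> makes this total; convergence is known on invariant functions
    and on their flow derivatives, by the two limits in \<open>q\<close>.\<close>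
  define V where "V = (\<lambda>f. Lim (at_right 0) (\<lambda>t. (f (\<xi> t) - f x) / q t))"
  have V: "V f = l" if "((\<lambda>t. (f (\<xi> t) - f x) / q t) \<longlongrightarrow> l) (at_right 0)" for f l
    unfolding V_def using that by (intro tendsto_Lim) simp_all
  have lim: "((\<lambda>t. (f (\<xi> t) - f x) / q t) \<longlongrightarrow> V f) (at_right 0)"
    and flow: "V (flow_derivative \<alpha> \<gamma> f) = \<mu> * V f" if "f \<in> invariant_functions" for f
    using q[OF that] V by metis+
  have "V (\<lambda>y. a * f y + b * h y) = a * V f + b * V h"
    if "f \<in> invariant_functions" "h \<in> invariant_functions" for f h a b
  proof (rule V)
    have "((\<lambda>t. a * ((f (\<xi> t) - f x) / q t) + b * ((h (\<xi> t) - h x) / q t)) \<longlongrightarrow> a * V f + b * V h) (at_right 0)"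
      by (intro tendsto_intros lim that)
    then show "((\<lambda>t. (a * f (\<xi> t) + b * h (\<xi> t) - (a * f x + b * h x)) / q t) \<longlongrightarrow> a * V f + b * V h) (at_right 0)"
      by (simp add: diff_divide_distrib add_divide_distrib algebra_simps)
  qed
  moreover have "V (\<lambda>y. f y * h y) = f x * V h + h x * V f"
    if "f \<in> invariant_functions" "h \<in> invariant_functions" for f h
  proof (rule V)
    have "smooth f" using that by (simp add: invariant_functions_def)
    then have "((\<lambda>t. f (\<xi> t) * ((h (\<xi> t) - h x) / q t) + h x * ((f (\<xi> t) - f x) / q t))
        \<longlongrightarrow> f x * V h + h x * V f) (at_right 0)"
      by (intro tendsto_add tendsto_mult tendsto_const lim that smooth_tendsto[OF _ \<xi>(2)])
    then show "((\<lambda>t. (f (\<xi> t) * h (\<xi> t) - f x * h x) / q t) \<longlongrightarrow> f x * V h + h x * V f) (at_right 0)"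
      by (simp add: diff_divide_distrib add_divide_distrib algebra_simps)
  qed
  moreover have "V f = 0" if "\<forall>y\<in>level_set lam rho. f y = 0" for f
  proof (rule V)
    show "((\<lambda>t. (f (\<xi> t) - f x) / q t) \<longlongrightarrow> 0) (at_right 0)"
      using \<xi>(1) by (intro tendsto_eventually) (auto elim!: eventually_mono simp: that x)
  qed
  ultimately have "reduced_tangent_vector lam rho x (\<lambda>f. complex_of_real (V f))"
    by (simp add: reduced_tangent_vector_def)
  moreover have "complex_of_real (V f0) \<noteq> 0" using V[OF f0(2)] f0(3) by simp
  ultimately have "linearisation_eigenvalue \<alpha> \<gamma> lam rho x (complex_of_real \<mu>)"
    unfolding linearisation_eigenvalue_def
    by (intro exI[of _ "\<lambda>f. complex_of_real (V f)"] conjI bexI[OF _ f0(1)] ballI) (simp_all add: flow)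
  then show ?thesis
    unfolding linearly_unstable_def using \<mu> by auto
qed

text \<open>Subtracting the infinitesimal rotation \<open>inf_rot \<eta>\<close>, which invariant functions do not see, turns
  the relative equilibrium \<open>x\<close> into a zero of the vector field; \<open>\<xi>'\<close> need only be an eigenvector
  modulo the tangent space of the orbit.\<close>

lemma linearly_unstable_first_order:
  assumes x: "x \<in> level_set lam rho"
    and \<xi>: "\<forall>\<^sub>F t in at_right 0. \<xi> t \<in> level_set lam rho" "\<xi> 0 = x"
      "(\<xi> has_vector_derivative \<xi>') (at 0)"
    and eq: "top_field \<alpha> \<gamma> x = inf_rot \<eta> x"
    and Y: "((\<lambda>t. top_field \<alpha> \<gamma> (\<xi> t) - inf_rot \<eta> (\<xi> t)) has_vector_derivative
      \<mu> *\<^sub>R \<xi>' + inf_rot h x) (at 0)"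
    and f0: "f0 \<in> invariant_functions" "frechet_derivative f0 (at x) \<xi>' \<noteq> 0" and \<mu>: "\<mu> \<noteq> 0"
  shows "linearly_unstable \<alpha> \<gamma> lam rho x"
proof (rule linearly_unstable_if_curve[OF x \<xi>(1) _ _ f0(1) _ f0(2) \<mu>, where q = "\<lambda>t. t"])
  show lim\<xi>: "(\<xi> \<longlongrightarrow> x) (at_right 0)"
    using has_vector_derivative_continuous[OF has_vector_derivative_at_within[OF \<xi>(3), of "{0<..}"]] \<xi>(2)
    by (simp add: continuous_within)
  have lim: "((\<lambda>t. (f (\<xi> t) - f x) / t) \<longlongrightarrow> frechet_derivative f (at x) \<xi>') (at_right 0)"
    if "f \<in> invariant_functions" for f
    using right_difference_quotient[of "\<lambda>t. f (\<xi> t)"] smooth_chain[OF _ \<xi>(3), of f] that \<xi>(2)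
    by (simp add: invariant_functions_def has_real_derivative_iff_has_vector_derivative field_simps)
  show "((\<lambda>t. (f0 (\<xi> t) - f0 x) / t) \<longlongrightarrow> frechet_derivative f0 (at x) \<xi>') (at_right 0)"
    by (rule lim[OF f0(1)])
  fix f assume f: "f \<in> invariant_functions"
  then have sm: "smooth f" by (simp add: invariant_functions_def)
  have l: "linear (frechet_derivative f (at y))" for y
    by (rule linear_frechet_derivative[OF smooth_differentiable[OF sm]])
  have flow: "flow_derivative \<alpha> \<gamma> f y = frechet_derivative f (at y) (top_field \<alpha> \<gamma> y - inf_rot \<eta> y)" for y
    by (simp add: flow_derivative_def linear_diff[OF l] invariant_inf_rot[OF f])
  \<comment> \<open>The corrected field vanishes at \<open>x\<close>, so dividing it by t gives its
    difference quotient. No second derivative of \<open>f\<close> enters.\<close>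
  have "((\<lambda>t. frechet_derivative f (at (\<xi> t)) ((top_field \<alpha> \<gamma> (\<xi> t) - inf_rot \<eta> (\<xi> t)) /\<^sub>R t)) \<longlongrightarrow>
      frechet_derivative f (at x) (\<mu> *\<^sub>R \<xi>' + inf_rot h x)) (at_right 0)"
    using right_difference_quotient[OF Y] eq \<xi>(2) by (intro tendsto_frechet_derivative sm lim\<xi>) simp
  then have "((\<lambda>t. (flow_derivative \<alpha> \<gamma> f (\<xi> t) - flow_derivative \<alpha> \<gamma> f x) / t) \<longlongrightarrow>
      \<mu> * frechet_derivative f (at x) \<xi>') (at_right 0)"
    using eq by (simp add: flow linear_scale[OF l] linear_add[OF l] linear_0[OF l]
        invariant_inf_rot[OF f] divide_inverse mult.commute[of _ "inverse _"])
  with lim[OF f] show "\<exists>l. ((\<lambda>t. (f (\<xi> t) - f x) / t) \<longlongrightarrow> l) (at_right 0) \<and>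
      ((\<lambda>t. (flow_derivative \<alpha> \<gamma> f (\<xi> t) - flow_derivative \<alpha> \<gamma> f x) / t) \<longlongrightarrow> \<mu> * l) (at_right 0)"
    by blast
qed

section \<open>Curves through the three kinds of upright equilibria\<close>

lemma inner_invariant:
  assumes "P = sumR \<or> P = difR"
  shows "(\<lambda>y. P y \<bullet> difR y) \<in> invariant_functions"
  using assms bounded_linear_components smooth_inner
  by (auto simp: invariant_functions_def conj_act_components rot_inner)

lemma sqrt_has_vector_derivative_0:
  assumes "(f has_vector_derivative 0) (at t)" "f t > (0::real)"
  shows "((\<lambda>t. sqrt (f t)) has_vector_derivative 0) (at t)"
  using DERIV_chain2[where f = sqrt and g = f, OF DERIV_real_sqrt[OF assms(2)], of 0 UNIV] assms(1)
  by (simp add: has_real_derivative_iff_has_vector_derivative)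

lemma has_vector_derivative_scaleR_const:
  "(f has_vector_derivative f') F \<Longrightarrow> ((\<lambda>t. f t *\<^sub>R v) has_vector_derivative f' *\<^sub>R v) F"
  by (rule bounded_linear.has_vector_derivative[OF bounded_linear_scaleR_left])

lemma has_vector_derivative_const_scaleR:
  "(f has_vector_derivative f') F \<Longrightarrow> ((\<lambda>t. c *\<^sub>R f t) has_vector_derivative c *\<^sub>R f') F"
  by (rule bounded_linear.has_vector_derivative[OF bounded_linear_scaleR_right])

lemma eventually_at_right_pos:
  assumes "isCont f 0" "f 0 > (0::real)"
  shows "\<forall>\<^sub>F t in at_right 0. f (t::real) > 0"
  using order_tendstoD(1)[OF assms(1)[unfolded isCont_def] assms(2)]
  by (rule filter_leD[OF at_le[OF subset_UNIV]])

text \<open>At such an equilibrium D and G are orthogonal and S is parallel to N = D \<times> G.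
  Moving S within the plane of D and G changes \<open>m\<close> and \<open>w\<close> to first order
  and leaves the other invariants stationary, which isolates the hyperbolic pair of
  equations.\<close>

lemma unstable_tilted:
  assumes \<alpha>: "\<alpha> > 0" and \<gamma>: "\<gamma> > 0" and x: "x \<in> level_set lam rho"
    and r: "0 < r" "r < 1"
    and i: "reduced_invariants x = (r, 0, k, 0, 0, d)"
    and e: "2 * \<gamma> * (1 - r\<^sup>2) = \<alpha> * (d - r * k)"
  shows "linearly_unstable \<alpha> \<gamma> lam rho x"
proof -
  define S D G N where "S = sumR x" and "D = difR x" and "G = vecG x" and "N = cross3 D G"
  define g2 where "g2 = 1 - r\<^sup>2"
  define \<mu> where "\<mu> = sqrt (2 * \<alpha> * \<gamma> * r)"
  have \<mu>: "\<mu> > 0" "\<mu>\<^sup>2 = 2 * \<alpha> * \<gamma> * r" using \<alpha> \<gamma> r by (simp_all add: \<mu>_def)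
  have xs: "x = state_of S D G r"
    using state_of_level_set[OF x] i by (simp add: S_def D_def G_def reduced_invariants_def)
  have inn: "D \<bullet> G = 0" "D \<bullet> D = k" "S \<bullet> D = 0" "S \<bullet> G = 0" "S \<bullet> N = d" "G \<bullet> G = g2"
    using i level_set_inner(1)[OF x] by (simp_all add: S_def D_def G_def N_def reduced_invariants_def g2_def)
  have g2: "g2 > 0" using r by (simp add: g2_def power_less_one_iff abs_square_less_1)
  have k: "k > 0"
  proof (rule ccontr)
    assume "\<not> k > 0"
    then have "D = 0" using inn(2) inner_ge_zero[of D] by (metis inner_eq_zero_iff order_le_less)
    then have "d = 0" "k = 0" using inn by (auto simp: N_def)
    then show False using e g2 \<gamma> by (simp add: g2_def)
  qed
  have NN: "N \<bullet> N = k * g2" using dot_cross[of D G D G] inn by (simp add: N_def)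
  have cr: "cross3 N D = k *\<^sub>R G" "cross3 N G = - (g2 *\<^sub>R D)" "cross3 D N = - (k *\<^sub>R G)"
    "cross3 G N = g2 *\<^sub>R D" "cross3 D G = N" "cross3 G D = - N"
    using inn Lagrange[of D D G] Lagrange[of G D G] cross_skew[of N D] cross_skew[of N G]
      cross_skew[of G D]
    by (simp_all add: N_def inner_commute)
  have N0: "D \<bullet> N = 0" "G \<bullet> N = 0" "N \<bullet> D = 0" "N \<bullet> G = 0"
    using dot_cross_self[of D G] dot_cross_self[of G D] by (simp_all add: N_def inner_commute)
  define \<sigma> where "\<sigma> = d / (k * g2)"
  have d: "d = \<sigma> * (k * g2)" using k g2 by (simp add: \<sigma>_def)
  have S: "S = \<sigma> *\<^sub>R N"
  proof -
    define z where "z = S - \<sigma> *\<^sub>R N"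
    have "z \<bullet> D = 0" "z \<bullet> G = 0" "N \<bullet> z = 0"
      using inn N0 by (simp_all add: z_def inner_simps NN d inner_commute)
    moreover from this have "cross3 N z = 0"
      using Lagrange[of z D G] cross_skew[of N z] by (simp add: N_def)
    moreover have "N \<noteq> 0" using NN k g2 by auto
    ultimately have "z = 0" using norm_and_cross_eq_0 by blast
    then show ?thesis by (simp add: z_def)
  qed
  have e': "\<alpha> * \<sigma> * k * g2 = 2 * \<gamma> * g2 + \<alpha> * r * k"
    using e by (simp add: d g2_def algebra_simps)
  have "\<alpha> * \<sigma> * k * g2 > 0" unfolding e' using \<alpha> \<gamma> g2 r k by (simp add: add_pos_pos)
  then have \<sigma>: "\<sigma> > 0" using \<alpha> k g2 by (simp add: zero_less_mult_iff)
  \<comment> \<open>Along the curve \<open>m\<close> and \<open>w\<close> have initial derivatives a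
    k and b g2. The eigenvector equations are \<mu> a k = - 2 \<gamma> b g2 and \<mu> b g2 = -
    \<alpha> r a k.\<close>
  define a b where "a = - 2 * \<gamma> * g2" and "b = \<mu> * k"
  \<comment> \<open>\<open>f1\<close> is chosen to preserve |S|. The factor \<open>q\<close> on D is
    the root near 1 of q^2 + 2 r sqrt(f1) q + t^2 C2 = 1 + 2 r \<sigma>, which is the condition on
    |lam| after removing r^2 |S|^2 and dividing by k g2. Both depend on t^2 only, so they do not
    disturb the velocity at t = 0.\<close>
  define C1 C2 where "C1 = (a\<^sup>2 * k + b\<^sup>2 * g2) / (k * g2)" and "C2 = b\<^sup>2 * g2 / k"
  define f1 where "f1 = (\<lambda>t. \<sigma>\<^sup>2 - t\<^sup>2 * C1)"
  define f2 where "f2 = (\<lambda>t. r\<^sup>2 * f1 t + (1 + 2 * r * \<sigma>) - t\<^sup>2 * C2)"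
  define q where "q = (\<lambda>t. - r * sqrt (f1 t) + sqrt (f2 t))"
  have f1_0: "f1 0 = \<sigma>\<^sup>2" and f2_0: "f2 0 = (1 + r * \<sigma>)\<^sup>2"
    by (simp_all add: f1_def f2_def power2_eq_square algebra_simps)
  have r\<sigma>: "1 + r * \<sigma> > 0" using \<sigma> r by (simp add: add_pos_pos)
  then have f0: "f1 0 > 0" "f2 0 > 0" using \<sigma> by (simp_all add: f1_0 f2_0)
  have f1': "(f1 has_vector_derivative 0) (at 0)"
    unfolding f1_def has_real_derivative_iff_has_vector_derivative[symmetric]
    by (auto intro!: derivative_eq_intros)
  have f2': "(f2 has_vector_derivative 0) (at 0)"
    unfolding f2_def f1_def has_real_derivative_iff_has_vector_derivative[symmetric]
    by (auto intro!: derivative_eq_intros)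
  note s1 = sqrt_has_vector_derivative_0[OF f1' f0(1)] sqrt_has_vector_derivative_0[OF f2' f0(2)]
  have q': "(q has_vector_derivative 0) (at 0)"
    using has_vector_derivative_add[OF has_vector_derivative_mult_right[OF s1(1), of "- r"] s1(2)]
    by (simp add: q_def)
  have q0: "q 0 = 1" using \<sigma> r\<sigma> by (simp add: q_def f1_0 f2_0)
  define St where "St = (\<lambda>t. sqrt (f1 t) *\<^sub>R N + t *\<^sub>R (a *\<^sub>R D + b *\<^sub>R G))"
  define \<xi> where "\<xi> = (\<lambda>t. state_of (St t) (q t *\<^sub>R D) G r)"
  have St0: "St 0 = S" using \<sigma> by (simp add: St_def f1_0 S)
  have \<xi>0: "\<xi> 0 = x" by (simp add: \<xi>_def St0 q0 xs)
  have St': "(St has_vector_derivative (a *\<^sub>R D + b *\<^sub>R G)) (at 0)"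
    using has_vector_derivative_add[OF has_vector_derivative_scaleR_const[OF s1(1)]
        has_vector_derivative_scaleR_const[OF has_vector_derivative_id]]
    by (simp add: St_def)
  have qv: "((\<lambda>t. q t *\<^sub>R v) has_vector_derivative 0) (at 0)" for v :: "real ^ 3"
    using has_vector_derivative_scaleR_const[OF q'] by simp
  have \<xi>': "(\<xi> has_vector_derivative state_of (a *\<^sub>R D + b *\<^sub>R G) 0 0 0) (at 0)"
    unfolding \<xi>_def by (intro has_vector_derivative_state_of St' qv has_vector_derivative_const)
  \<comment> \<open>The equilibrium turns rigidly about N; the rate is read off from D' = - 2
    \<gamma> G and N \<times> D = k G.\<close>
  define \<eta> where "\<eta> = (- (2 * \<gamma> / k)) *\<^sub>R N"
  have \<eta>: "cross3 \<eta> D = (- 2 * \<gamma>) *\<^sub>R G" "cross3 \<eta> G = (2 * \<gamma> * g2 / k) *\<^sub>R D"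
    "cross3 \<eta> S = 0"
    using k by (simp_all add: \<eta>_def cross_mult_left cross_mult_right cr S)
  have coef: "\<alpha> * (\<sigma> * g2 - r) = 2 * \<gamma> * g2 / k"
    using e' k by (simp add: field_simps)
  show ?thesis
  proof (rule linearly_unstable_first_order[OF x _ \<xi>0 \<xi>'])
    have "isCont f1 0" "isCont f2 0"
      using f1' f2' by (auto dest: has_vector_derivative_continuous)
    then have "\<forall>\<^sub>F t in at_right 0. f1 t > 0 \<and> f2 t > 0"
      using f0 eventually_at_right_pos by (intro eventually_conj) auto
    then show "\<forall>\<^sub>F t in at_right 0. \<xi> t \<in> level_set lam rho"
    proof (rule eventually_mono)
      fix t assume t: "f1 t > 0 \<and> f2 t > 0"
      define p where "p = sqrt (f1 t)"
      have p: "p\<^sup>2 = f1 t" using t by (simp add: p_def)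
      have "(q t + r * p)\<^sup>2 = f2 t" using t by (simp add: p_def q_def)
      then have Q0: "(q t)\<^sup>2 + 2 * r * p * q t + t\<^sup>2 * C2 = 1 + 2 * r * \<sigma>"
        by (simp add: f2_def p[symmetric] power2_eq_square algebra_simps)
      have "k * C2 = b\<^sup>2 * g2" using k by (simp add: C2_def)
      with Q0 have Q: "(k * g2) * ((q t)\<^sup>2 + 2 * r * p * q t) + t\<^sup>2 * b\<^sup>2 * g2\<^sup>2 = (k * g2) * (1 + 2 * r * \<sigma>)"
        by algebra
      have P: "p\<^sup>2 * (k * g2) + t\<^sup>2 * (a\<^sup>2 * k + b\<^sup>2 * g2) = \<sigma>\<^sup>2 * (k * g2)"
        using k g2 by (simp add: p f1_def C1_def field_simps)
      have StSt: "St t \<bullet> St t = S \<bullet> S"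
        using P by (simp add: St_def S inner_simps NN N0 inn inner_commute[of G D] power2_eq_square
            algebra_simps flip: p_def)
      have SN: "St t \<bullet> N = p * (k * g2)" "St t \<bullet> G = t * b * g2"
        using inn N0 by (simp_all add: St_def inner_simps NN flip: p_def)
      have nn: "(norm (r *\<^sub>R A + c *\<^sub>R N))\<^sup>2 = r\<^sup>2 * (A \<bullet> A) + 2 * r * c * (A \<bullet> N) + c\<^sup>2 * (k * g2)" for A c
        unfolding power2_norm_eq_inner by (simp add: inner_simps NN inner_commute power2_eq_square algebra_simps)
      have "(norm lam)\<^sup>2 = (norm (r *\<^sub>R S + 1 *\<^sub>R N))\<^sup>2"
        using x inn by (simp add: level_set_iff xs cr)
      also have "\<dots> = (t * b * g2)\<^sup>2 + (norm (r *\<^sub>R St t + q t *\<^sub>R N))\<^sup>2"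
        unfolding nn StSt SN using Q inn(5) by (simp add: d power_mult_distrib algebra_simps)
      finally show "\<xi> t \<in> level_set lam rho"
        using x inn StSt SN by (simp add: \<xi>_def xs level_set_iff cr cross_mult_left norm_eq_sqrt_inner)
    qed
    show "top_field \<alpha> \<gamma> x = inf_rot \<eta> x"
    proof -
      have "\<alpha> *\<^sub>R (- r *\<^sub>R D + cross3 G S) = (\<alpha> * (\<sigma> * g2 - r)) *\<^sub>R D"
        by (simp add: S cross_mult_right cr algebra_simps)
      then show ?thesis
        by (simp add: xs top_field_state_of inf_rot_state_of \<eta> inn coef)
    qed
    have Y: "top_field \<alpha> \<gamma> (\<xi> t) - inf_rot \<eta> (\<xi> t) = state_of (- cross3 \<eta> (St t))
        ((- 2 * \<gamma>) *\<^sub>R G - q t *\<^sub>R cross3 \<eta> D)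
        (\<alpha> *\<^sub>R (- r *\<^sub>R (q t *\<^sub>R D) + cross3 G (St t)) - cross3 \<eta> G) 0" for t
      by (simp add: \<xi>_def top_field_state_of inf_rot_state_of state_of_arith cross_mult_right inn)
    note crs = bounded_linear.has_vector_derivative[OF
        bounded_bilinear.bounded_linear_right[OF bounded_bilinear_cross3] St']
    have "((\<lambda>t. top_field \<alpha> \<gamma> (\<xi> t) - inf_rot \<eta> (\<xi> t)) has_vector_derivative
        state_of (- cross3 \<eta> (a *\<^sub>R D + b *\<^sub>R G)) (0 - 0)
          (\<alpha> *\<^sub>R (- r *\<^sub>R 0 + cross3 G (a *\<^sub>R D + b *\<^sub>R G)) - 0) 0) (at 0)"
      unfolding Y
      by (intro has_vector_derivative_state_of has_vector_derivative_minus has_vector_derivative_diff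
          has_vector_derivative_add has_vector_derivative_const_scaleR has_vector_derivative_const crs qv)
    \<comment> \<open>The compensating rotation is parallel to D because the D component of the
      velocity is zero; the G component then determines its coefficient - \<alpha> a.\<close>
    moreover have "state_of (- cross3 \<eta> (a *\<^sub>R D + b *\<^sub>R G)) (0 - 0)
          (\<alpha> *\<^sub>R (- r *\<^sub>R 0 + cross3 G (a *\<^sub>R D + b *\<^sub>R G)) - 0) 0
        = \<mu> *\<^sub>R state_of (a *\<^sub>R D + b *\<^sub>R G) 0 0 0 + inf_rot ((- \<alpha> * a) *\<^sub>R D) x"
    proof -
      have "2 * \<gamma> * a = \<mu> * b + \<alpha> * a * \<sigma> * k"
      proof -
        have "\<mu> * b = k * (2 * \<alpha> * \<gamma> * r)"
          unfolding b_def \<mu>(2)[symmetric] by (simp add: power2_eq_square)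
        then show ?thesis using e' by (simp add: a_def) algebra
      qed
      moreover have "- (2 * \<gamma> * b * g2 / k) = \<mu> * a"
        using k by (simp add: a_def b_def)
      moreover have "- cross3 \<eta> (a *\<^sub>R D + b *\<^sub>R G) = (2 * \<gamma> * a) *\<^sub>R G + (- (2 * \<gamma> * b * g2 / k)) *\<^sub>R D"
        by (simp add: cross_add_right cross_mult_right \<eta> algebra_simps)
      ultimately show ?thesis
        by (simp add: xs inf_rot_state_of state_of_arith cross_add_right cross_mult_right
            cross_mult_left cr S algebra_simps)
    qed
    ultimately show "((\<lambda>t. top_field \<alpha> \<gamma> (\<xi> t) - inf_rot \<eta> (\<xi> t)) has_vector_derivative
        \<mu> *\<^sub>R state_of (a *\<^sub>R D + b *\<^sub>R G) 0 0 0 + inf_rot ((- \<alpha> * a) *\<^sub>R D) x) (at 0)" by simp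
    show "(\<lambda>y. sumR y \<bullet> difR y) \<in> invariant_functions" by (simp add: inner_invariant)
    have "((\<lambda>y. sumR y \<bullet> difR y) has_derivative (\<lambda>v. sumR x \<bullet> difR v + sumR v \<bullet> difR x)) (at x)"
      by (intro has_derivative_inner bounded_linear_imp_has_derivative bounded_linear_components)
    from frechet_derivative_at[OF this, symmetric]
    show "frechet_derivative (\<lambda>y. sumR y \<bullet> difR y) (at x) (state_of (a *\<^sub>R D + b *\<^sub>R G) 0 0 0) \<noteq> 0"
      using k g2 \<gamma> inn by (simp add: xs inner_simps inner_commute a_def)
    show "\<mu> \<noteq> 0" using \<mu> by simp
  qed
qed

text \<open>With D and G kept parallel to S all cross products vanish, and to first order D' = - 2
  \<gamma> G and G' = - \<alpha> D. The growing solution has D = 2 \<gamma> S and G = - \<mu> S.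
  Correcting \<open>r\<close> so that |g| = 1 preserves |lam| as well.\<close>

lemma unstable_aligned:
  assumes \<alpha>: "\<alpha> > 0" and \<gamma>: "\<gamma> > 0" and x: "x \<in> level_set lam rho"
    and xs: "x = state_of S 0 0 1" and S: "S \<noteq> 0"
  shows "linearly_unstable \<alpha> \<gamma> lam rho x"
proof -
  define \<mu> where "\<mu> = sqrt (2 * \<alpha> * \<gamma>)"
  have \<mu>: "\<mu> > 0" "\<mu> * \<mu> = 2 * \<alpha> * \<gamma>" using \<alpha> \<gamma> by (simp_all add: \<mu>_def)
  define r where "r = (\<lambda>t. sqrt (1 - t\<^sup>2 * (\<mu>\<^sup>2 * (S \<bullet> S))))"
  have r: "((\<lambda>t. 1 - t\<^sup>2 * (\<mu>\<^sup>2 * (S \<bullet> S))) has_vector_derivative 0) (at 0)"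
    unfolding has_real_derivative_iff_has_vector_derivative[symmetric]
    by (auto intro!: derivative_eq_intros)
  have r': "(r has_vector_derivative 0) (at 0)"
    unfolding r_def by (rule sqrt_has_vector_derivative_0[OF r]) simp
  have r0: "r 0 = 1" by (simp add: r_def)
  define \<xi> where "\<xi> = (\<lambda>t. state_of S ((t * (2 * \<gamma>)) *\<^sub>R S) ((t * - \<mu>) *\<^sub>R S) (r t))"
  have lin: "((\<lambda>t. (t * c) *\<^sub>R S) has_vector_derivative c *\<^sub>R S) (at 0)" for c
    by (auto intro!: derivative_eq_intros)
  have \<xi>': "(\<xi> has_vector_derivative state_of 0 ((2 * \<gamma>) *\<^sub>R S) ((- \<mu>) *\<^sub>R S) 0) (at 0)"
    unfolding \<xi>_def by (intro has_vector_derivative_state_of lin r' has_vector_derivative_const)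
  show ?thesis
  proof (rule linearly_unstable_first_order[OF x _ _ \<xi>', where \<eta> = 0 and h = 0])
    show "\<xi> 0 = x" by (simp add: \<xi>_def xs r0)
    have "isCont (\<lambda>t. 1 - t\<^sup>2 * (\<mu>\<^sup>2 * (S \<bullet> S))) 0"
      using r by (auto dest: has_vector_derivative_continuous)
    from eventually_at_right_pos[OF this]
    have "\<forall>\<^sub>F t in at_right 0. 1 - t\<^sup>2 * (\<mu>\<^sup>2 * (S \<bullet> S)) > 0" by simp
    then show "\<forall>\<^sub>F t in at_right 0. \<xi> t \<in> level_set lam rho"
    proof (rule eventually_mono)
      fix t assume "1 - t\<^sup>2 * (\<mu>\<^sup>2 * (S \<bullet> S)) > 0"
      then have r2: "(r t)\<^sup>2 = 1 - t\<^sup>2 * (\<mu>\<^sup>2 * (S \<bullet> S))" by (simp add: r_def)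
      have l: "(norm lam)\<^sup>2 = (norm S)\<^sup>2" "norm rho = norm S"
        using x by (simp_all add: xs level_set_iff)
      have "(t * \<mu> * (S \<bullet> S))\<^sup>2 + (r t)\<^sup>2 * (S \<bullet> S) = S \<bullet> S"
        unfolding r2 by (simp add: power2_eq_square algebra_simps)
      then show "\<xi> t \<in> level_set lam rho"
        unfolding level_set_iff l using r2
        by (simp add: \<xi>_def cross_mult_left cross_mult_right power_mult_distrib
            flip: power2_norm_eq_inner)
    qed
    show "top_field \<alpha> \<gamma> x = inf_rot 0 x"
      by (simp add: xs top_field_state_of inf_rot_state_of)
    have Y: "top_field \<alpha> \<gamma> (\<xi> t) - inf_rot 0 (\<xi> t) = state_of 0 ((t * (2 * \<gamma> * \<mu>)) *\<^sub>R S)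
        (r t *\<^sub>R ((t * (- \<mu> * \<mu>)) *\<^sub>R S)) (t\<^sup>2 * (- \<mu> * \<mu> * \<mu> * (S \<bullet> S)))" for t
      unfolding mult_minus_left \<mu>(2)
      by (simp add: \<xi>_def top_field_state_of inf_rot_state_of state_of_arith cross_mult_right
          cross_mult_left power2_eq_square algebra_simps)
    have "((\<lambda>t. top_field \<alpha> \<gamma> (\<xi> t) - inf_rot 0 (\<xi> t)) has_vector_derivative
        state_of 0 ((2 * \<gamma> * \<mu>) *\<^sub>R S) (r 0 *\<^sub>R ((- \<mu> * \<mu>) *\<^sub>R S) + 0 *\<^sub>R ((0 * (- \<mu> * \<mu>)) *\<^sub>R S)) 0) (at 0)"
      unfolding Y
    proof (intro has_vector_derivative_state_of lin has_vector_derivative_const)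
      show "((\<lambda>t. r t *\<^sub>R ((t * (- \<mu> * \<mu>)) *\<^sub>R S)) has_vector_derivative
          r 0 *\<^sub>R ((- \<mu> * \<mu>) *\<^sub>R S) + 0 *\<^sub>R ((0 * (- \<mu> * \<mu>)) *\<^sub>R S)) (at 0)"
        by (rule has_vector_derivative_scaleR[OF _ lin])
          (use r' in \<open>simp add: has_real_derivative_iff_has_vector_derivative\<close>)
      show "((\<lambda>t. t\<^sup>2 * (- \<mu> * \<mu> * \<mu> * (S \<bullet> S))) has_vector_derivative 0) (at 0)"
        unfolding has_real_derivative_iff_has_vector_derivative[symmetric]
        by (auto intro!: derivative_eq_intros)
    qed
    then show "((\<lambda>t. top_field \<alpha> \<gamma> (\<xi> t) - inf_rot 0 (\<xi> t)) has_vector_derivative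
        \<mu> *\<^sub>R state_of 0 ((2 * \<gamma>) *\<^sub>R S) ((- \<mu>) *\<^sub>R S) 0 + inf_rot 0 x) (at 0)"
      by (simp add: r0 xs inf_rot_state_of state_of_arith mult.commute)
    show "(\<lambda>y. sumR y \<bullet> difR y) \<in> invariant_functions" by (simp add: inner_invariant)
    have "((\<lambda>y. sumR y \<bullet> difR y) has_derivative (\<lambda>v. sumR x \<bullet> difR v + sumR v \<bullet> difR x)) (at x)"
      by (intro has_derivative_inner bounded_linear_imp_has_derivative bounded_linear_components)
    from frechet_derivative_at[OF this, symmetric]
    show "frechet_derivative (\<lambda>y. sumR y \<bullet> difR y) (at x)
        (state_of 0 ((2 * \<gamma>) *\<^sub>R S) ((- \<mu>) *\<^sub>R S) 0) \<noteq> 0"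
      using S \<gamma> by (simp add: xs)
    show "\<mu> \<noteq> 0" using \<mu> by simp
  qed
qed

text \<open>The half-turn about an axis orthogonal to \<open>e\<close> makes \<open>f (\<xi> t)\<close> even in \<open>t\<close>, so that its leading
  term is of second order and the eigenvalue of the reduced linearisation is \<open>2 * \<mu>\<close>.\<close>

lemma unstable_at_rest:
  assumes \<alpha>: "\<alpha> > 0" and \<gamma>: "\<gamma> > 0" and x: "x \<in> level_set lam rho"
    and xs: "x = state_of 0 0 0 1"
  shows "linearly_unstable \<alpha> \<gamma> lam rho x"
proof -
  define \<mu> where "\<mu> = sqrt (2 * \<alpha> * \<gamma>)"
  have \<mu>: "\<mu> > 0" "\<mu> * \<mu> = 2 * \<alpha> * \<gamma>" using \<alpha> \<gamma> by (simp_all add: \<mu>_def)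
  obtain e n :: "real ^ 3" where e: "norm e = 1" and n: "norm n = 1" "n \<bullet> e = 0"
    using exists_orthogonal_unit3 by metis
  define h where "h = (\<lambda>t. 1 - t\<^sup>2 * \<mu>\<^sup>2)"
  define r where "r = (\<lambda>t. sqrt (h t))"
  define w where "w = (\<lambda>t. state_of 0 ((2 * \<gamma>) *\<^sub>R e) ((- \<mu>) *\<^sub>R e) (- (t * \<mu>\<^sup>2 / r t)))"
  define \<xi> where "\<xi> = (\<lambda>t. state_of 0 ((t * (2 * \<gamma>)) *\<^sub>R e) ((t * - \<mu>) *\<^sub>R e) (r t))"
  have h': "(h has_real_derivative - 2 * t * \<mu>\<^sup>2) (at t)" for t
    unfolding h_def by (auto intro!: derivative_eq_intros)
  have r': "(r has_vector_derivative - (t * \<mu>\<^sup>2 / r t)) (at t)" if "h t > 0" for t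
  proof -
    have "(r has_real_derivative inverse (sqrt (h t)) / 2 * (- 2 * t * \<mu>\<^sup>2)) (at t)"
      unfolding r_def by (rule DERIV_chain2[where f = sqrt and g = h, OF DERIV_real_sqrt[OF that] h'])
    moreover have "inverse y / 2 * (- 2 * t * z) = - (t * z / y)" for y z :: real
      by (simp add: field_simps)
    then have "inverse (sqrt (h t)) / 2 * (- 2 * t * \<mu>\<^sup>2) = - (t * \<mu>\<^sup>2 / r t)"
      unfolding r_def .
    ultimately show ?thesis by (simp only: has_real_derivative_iff_has_vector_derivative)
  qed
  have lin: "((\<lambda>t. (t * c) *\<^sub>R e) has_vector_derivative c *\<^sub>R e) (at t)" for c t
  proof -
    have "((\<lambda>t. t * c) has_vector_derivative 1 * c) (at t)"
      by (intro has_vector_derivative_mult_left has_vector_derivative_id)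
    then show ?thesis using has_vector_derivative_scaleR_const by fastforce
  qed
  have \<xi>': "(\<xi> has_vector_derivative w t) (at t)" if "h t > 0" for t
    unfolding \<xi>_def w_def
    by (intro has_vector_derivative_state_of lin r'[OF that] has_vector_derivative_const)
  have h0: "h 0 = 1" "r 0 = 1" by (simp_all add: h_def r_def)
  have \<xi>0: "\<xi> 0 = x" by (simp add: \<xi>_def h0 xs)
  have ev: "\<forall>\<^sub>F t in at_right 0. h t > 0"
    using DERIV_isCont[OF h'] h0 by (intro eventually_at_right_pos) auto
  have ev0: "\<forall>\<^sub>F t in at_right (0::real). t > 0" by (simp add: eventually_at_filter)
  have right: "(f \<longlongrightarrow> f 0) (at_right 0)" if "(f has_vector_derivative f') (at 0)"
    for f :: "real \<Rightarrow> 'a::real_normed_vector" and f'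
    using has_vector_derivative_continuous[OF has_vector_derivative_at_within[OF that, of "{0<..}"]]
    by (simp add: continuous_within)
  have r0': "(r has_vector_derivative 0) (at 0)" using r'[of 0] h0 by simp
  have r_lim: "(r \<longlongrightarrow> 1) (at_right 0)" using right[OF r0'] h0 by simp
  have \<xi>_lim: "(\<xi> \<longlongrightarrow> x) (at_right 0)" using right[OF \<xi>'[of 0]] \<xi>0 h0 by simp
  show ?thesis
  proof (rule linearly_unstable_if_curve[OF x _ \<xi>_lim, where q = "\<lambda>t. t\<^sup>2" and \<mu> = "2 * \<mu>"])
    show "\<forall>\<^sub>F t in at_right 0. \<xi> t \<in> level_set lam rho"
      using ev
    proof (rule eventually_mono)
      fix t assume "h t > 0"
      then have r2: "(r t)\<^sup>2 + t\<^sup>2 * \<mu>\<^sup>2 = 1" by (simp add: r_def h_def)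
      have l: "norm lam = 0" "norm rho = 0"
        using x by (simp_all add: xs level_set_iff)
      show "\<xi> t \<in> level_set lam rho"
        unfolding level_set_iff l using r2 e
        by (simp add: \<xi>_def cross_mult_left cross_mult_right power_mult_distrib power2_eq_square
            dot_square_norm ac_simps)
    qed
    \<comment> \<open>With S = 0 the invariant \<open>m\<close> vanishes along the curve, and |D|^2
      detects the motion at second order.\<close>
    show "(\<lambda>y. difR y \<bullet> difR y) \<in> invariant_functions" by (simp add: inner_invariant)
    have "\<forall>\<^sub>F t in at_right 0. (difR (\<xi> t) \<bullet> difR (\<xi> t) - difR x \<bullet> difR x) / t\<^sup>2 = 4 * \<gamma>\<^sup>2"
      using ev0 by (rule eventually_mono) (simp add: \<xi>_def xs dot_square_norm e power2_eq_square)
    then show "((\<lambda>t. (difR (\<xi> t) \<bullet> difR (\<xi> t) - difR x \<bullet> difR x) / t\<^sup>2) \<longlongrightarrow> 4 * \<gamma>\<^sup>2) (at_right 0)"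
      by (rule tendsto_eventually)
    show "4 * \<gamma>\<^sup>2 \<noteq> 0" "2 * \<mu> \<noteq> 0" using \<gamma> \<mu> by simp_all
  next
    fix f assume f: "f \<in> invariant_functions"
    then have sm: "smooth f" by (simp add: invariant_functions_def)
    define Df where "Df = (\<lambda>y. frechet_derivative f (at y))"
    have l: "linear (Df y)" for y
      unfolding Df_def by (rule linear_frechet_derivative[OF smooth_differentiable[OF sm]])
    have \<phi>': "((\<lambda>t. f (\<xi> t)) has_real_derivative Df (\<xi> t) (w t)) (at t)" if "h t > 0" for t
      unfolding Df_def by (rule smooth_chain[OF sm \<xi>'[OF that]])
    have even: "f (\<xi> (- t)) = f (\<xi> t)" for t
    proof -
      have s: "norm (0::real, n) = 1" using n by (simp add: norm_prod_def)
      have "conj_act (0, n) (\<xi> t) = \<xi> (- t)"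
        by (simp add: \<xi>_def state_of_def conj_act_rot[OF s] half_turn[OF n(1)] n r_def h_def)
      moreover have "f (conj_act (0, n) (\<xi> t)) = f (\<xi> t)"
        using f s unfolding invariant_functions_def by blast
      ultimately show ?thesis by simp
    qed
    \<comment> \<open>The velocity w t is w 0 plus t times a convergent vector, so only the part
      with the fixed direction w 0 has to be differentiated at 0. Evenness makes that part vanish
      there.\<close>
    define \<psi> where "\<psi> = (\<lambda>t. Df (\<xi> t) (w 0))"
    have "\<psi> 0 = 0"
    proof -
      have d: "((\<lambda>t. f (\<xi> t)) has_real_derivative \<psi> 0) (at 0)"
        using \<phi>'[of 0] h0 by (simp add: \<psi>_def)
      have "((\<lambda>t. f (\<xi> (- t))) has_real_derivative \<psi> 0 * - 1) (at 0)"
        by (rule DERIV_chain2[where f = "\<lambda>t. f (\<xi> t)" and g = uminus])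
          (auto intro!: derivative_eq_intros simp: d)
      then have "\<psi> 0 * - 1 = \<psi> 0"
        unfolding even using d by (rule DERIV_unique)
      then show ?thesis by simp
    qed
    have "smooth (\<lambda>y. Df y (w 0))"
      unfolding Df_def by (rule smooth_frechet_derivative[OF sm])
    from smooth_chain[OF this \<xi>'[of 0]] h0 obtain \<psi>' where
      "(\<psi> has_vector_derivative \<psi>') (at 0)"
      by (auto simp: \<psi>_def has_real_derivative_iff_has_vector_derivative)
    from right_difference_quotient[OF this] \<open>\<psi> 0 = 0\<close>
    have \<psi>': "((\<lambda>t. \<psi> t / t) \<longlongrightarrow> \<psi>') (at_right 0)" by (simp add: divide_inverse mult.commute)
    \<comment> \<open>\<open>L\<close> plays the role of the second derivative of f (\<xi> t) at 0.
      The difference quotient for t^2 therefore tends to L / 2 and that of the flow derivative to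
      \<mu> L, with ratio 2 \<mu>.\<close>
    define L where "L = \<psi>' + Df x (state_of 0 0 0 (- (\<mu>\<^sup>2 / 1)))"
    have L: "((\<lambda>t. Df (\<xi> t) (w t) / t) \<longlongrightarrow> L) (at_right 0)"
    proof (rule Lim_transform_eventually)
      show "((\<lambda>t. \<psi> t / t + Df (\<xi> t) (state_of 0 0 0 (- (\<mu>\<^sup>2 / r t)))) \<longlongrightarrow> L) (at_right 0)"
        unfolding L_def Df_def
        by (intro tendsto_add \<psi>' tendsto_frechet_derivative[OF sm \<xi>_lim] tendsto_state_of
            tendsto_const tendsto_minus tendsto_divide r_lim) simp
      show "\<forall>\<^sub>F t in at_right 0. \<psi> t / t + Df (\<xi> t) (state_of 0 0 0 (- (\<mu>\<^sup>2 / r t))) = Df (\<xi> t) (w t) / t"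
        using ev0
      proof (rule eventually_mono)
        fix t :: real assume t: "t > 0"
        have "w t = w 0 + t *\<^sub>R state_of 0 0 0 (- (\<mu>\<^sup>2 / r t))"
          by (simp add: w_def state_of_arith)
        then show "\<psi> t / t + Df (\<xi> t) (state_of 0 0 0 (- (\<mu>\<^sup>2 / r t))) = Df (\<xi> t) (w t) / t"
          using t by (simp add: \<psi>_def linear_add[OF l] linear_scale[OF l] add_divide_distrib)
      qed
    qed
    have "((\<lambda>t. (f (\<xi> t) - f x) / t\<^sup>2) \<longlongrightarrow> L / 2) (at_right 0)"
    proof (rule lhopital_right_0)
      show "((\<lambda>t. f (\<xi> t) - f x) \<longlongrightarrow> 0) (at_right 0)"
        using smooth_tendsto[OF sm \<xi>_lim] by (simp add: LIM_zero)
      show "((\<lambda>t. t\<^sup>2) \<longlongrightarrow> 0) (at_right (0::real))"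
        by (auto intro!: tendsto_eq_intros)
      show "\<forall>\<^sub>F t in at_right 0. t\<^sup>2 \<noteq> (0::real)" "\<forall>\<^sub>F t in at_right 0. 2 * t \<noteq> (0::real)"
        using ev0 by (auto elim: eventually_mono)
      show "\<forall>\<^sub>F t in at_right 0. ((\<lambda>t. f (\<xi> t) - f x) has_real_derivative Df (\<xi> t) (w t)) (at t)"
        using ev by (rule eventually_mono) (auto intro!: derivative_eq_intros \<phi>')
      show "\<forall>\<^sub>F t in at_right 0. ((\<lambda>t. t\<^sup>2) has_real_derivative 2 * t) (at t)"
        using DERIV_pow[of 2] by (simp add: numeral_2_eq_2)
      show "filterlim (\<lambda>t. Df (\<xi> t) (w t) / (2 * t)) (nhds (L / 2)) (at_right 0)"
        using tendsto_divide[OF L tendsto_const[of 2]] by (simp add: mult.commute)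
    qed
    moreover
    \<comment> \<open>The field at \<xi> t is \<mu> t w t + t^2 z t: up to the remainder
      \<open>z\<close>, which tends to 0, the curve is traversed with t' = \<mu> t.\<close>
    define z where "z = (\<lambda>t. state_of 0 0 ((- (\<mu> * \<mu>) * ((r t - r 0) /\<^sub>R t)) *\<^sub>R e)
      (- (\<mu> ^ 3) * (1 - 1 / r t)))"
    have "((\<lambda>t. (flow_derivative \<alpha> \<gamma> f (\<xi> t) - flow_derivative \<alpha> \<gamma> f x) / t\<^sup>2) \<longlongrightarrow> \<mu> * L + Df x (state_of 0 0 ((- (\<mu> * \<mu>) * 0) *\<^sub>R e)
      (- (\<mu> ^ 3) * (1 - 1 / 1)))) (at_right 0)"
    proof (rule Lim_transform_eventually)
      show "((\<lambda>t. \<mu> * (Df (\<xi> t) (w t) / t) + Df (\<xi> t) (z t)) \<longlongrightarrow> \<mu> * L + Df x (state_of 0 0 ((- (\<mu> * \<mu>) * 0) *\<^sub>R e)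
          (- (\<mu> ^ 3) * (1 - 1 / 1)))) (at_right 0)"
        using right_difference_quotient[OF r0'] unfolding z_def Df_def
        by (intro tendsto_add tendsto_mult tendsto_const L[unfolded Df_def]
            tendsto_frechet_derivative[OF sm \<xi>_lim] tendsto_state_of tendsto_scaleR
            tendsto_diff tendsto_divide r_lim) simp_all
      show "\<forall>\<^sub>F t in at_right 0. \<mu> * (Df (\<xi> t) (w t) / t) + Df (\<xi> t) (z t)
          = (flow_derivative \<alpha> \<gamma> f (\<xi> t) - flow_derivative \<alpha> \<gamma> f x) / t\<^sup>2"
        using eventually_conj[OF ev ev0]
      proof (rule eventually_mono)
        fix t assume t: "h t > 0 \<and> t > 0"
        have "top_field \<alpha> \<gamma> x = 0"
          unfolding xs top_field_state_of by (simp add: state_of_def zero_prod_def)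
        then have "flow_derivative \<alpha> \<gamma> f x = 0"
          using linear_0[OF l[of x]] by (simp add: flow_derivative_def Df_def)
        moreover have "top_field \<alpha> \<gamma> (\<xi> t) = (\<mu> * t) *\<^sub>R w t + t\<^sup>2 *\<^sub>R z t"
        proof -
          have rt: "r t > 0" using t by (simp add: r_def)
          have "\<alpha> *\<^sub>R (- r t *\<^sub>R (t * (2 * \<gamma>)) *\<^sub>R e) = (- (2 * \<alpha> * \<gamma>) * t * r t) *\<^sub>R e"
            by simp
          also have "- (2 * \<alpha> * \<gamma>) * t * r t
              = \<mu> * t * - \<mu> + t\<^sup>2 * (- (\<mu> * \<mu>) * ((r t - r 0) /\<^sub>R t))"
            unfolding \<mu>(2)[symmetric] using t by (simp add: h0 power2_eq_square field_simps)
          finally have G: "\<alpha> *\<^sub>R (- r t *\<^sub>R (t * (2 * \<gamma>)) *\<^sub>R e)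
              = (\<mu> * t) *\<^sub>R (- \<mu>) *\<^sub>R e + t\<^sup>2 *\<^sub>R (- (\<mu> * \<mu>) * ((r t - r 0) /\<^sub>R t)) *\<^sub>R e"
            by (simp only: scaleR_add_left scaleR_scaleR)
          have "\<alpha> * ((t * (2 * \<gamma>)) *\<^sub>R e \<bullet> (t * - \<mu>) *\<^sub>R e) = - (t\<^sup>2 * \<mu> * (2 * \<alpha> * \<gamma>))"
            using e by (simp add: dot_square_norm power2_eq_square)
          also have "\<dots> = \<mu> * t * - (t * \<mu>\<^sup>2 / r t) + t\<^sup>2 * (- (\<mu> ^ 3) * (1 - 1 / r t))"
            unfolding \<mu>(2)[symmetric] using rt
            by (simp add: power2_eq_square power3_eq_cube field_simps)
          finally show ?thesis
            unfolding \<xi>_def w_def z_def top_field_state_of state_of_arith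
            by (simp only: G cross_zero_right scaleR_zero_right add_0_right) (simp add: mult_ac)
        qed
        ultimately show "\<mu> * (Df (\<xi> t) (w t) / t) + Df (\<xi> t) (z t)
            = (flow_derivative \<alpha> \<gamma> f (\<xi> t) - flow_derivative \<alpha> \<gamma> f x) / t\<^sup>2"
          using t by (simp add: flow_derivative_def Df_def linear_add[OF l[unfolded Df_def]]
              linear_scale[OF l[unfolded Df_def]] power2_eq_square field_simps)
      qed
    qed
    moreover have "Df x (state_of 0 0 ((- (\<mu> * \<mu>) * 0) *\<^sub>R e) (- (\<mu> ^ 3) * (1 - 1 / 1))) = 0"
      using linear_0[OF l[of x]] by (simp add: state_of_def zero_prod_def)
    ultimately show "\<exists>l. ((\<lambda>t. (f (\<xi> t) - f x) / t\<^sup>2) \<longlongrightarrow> l) (at_right 0) \<and>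
        ((\<lambda>t. (flow_derivative \<alpha> \<gamma> f (\<xi> t) - flow_derivative \<alpha> \<gamma> f x) / t\<^sup>2) \<longlongrightarrow> 2 * \<mu> * l) (at_right 0)"
      by (intro exI[of _ "L / 2"]) simp
  qed
qed

lemma upright_unstable:
  assumes \<alpha>: "\<alpha> > 0" and \<gamma>: "\<gamma> > 0" and x: "x \<in> level_set lam rho"
    and re: "relative_equilibrium \<alpha> \<gamma> lam rho (orbit x)"
    and h: "reG x > 0"
  shows "linearly_unstable \<alpha> \<gamma> lam rho x"
proof -
  obtain r u k m w d where i: "reduced_invariants x = (r, u, k, m, w, d)" by (metis surj_pair)
  note eqs = relative_equilibrium_equations[OF re \<alpha> \<gamma> i]
  have ri: "reG x = r" "difR x \<bullet> difR x = k" "sumR x \<bullet> cross3 (difR x) (vecG x) = d"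
    using i by (simp_all add: reduced_invariants_def)
  have i: "reduced_invariants x = (r, 0, k, 0, 0, d)" using i eqs h ri by simp
  have "r\<^sup>2 \<le> 1" using level_set_inner(1)[OF x] ri by (metis diff_ge_0_iff_ge inner_ge_zero)
  then have r1: "r \<le> 1" by (simp add: abs_square_le_1)
  show ?thesis
  proof (cases "r = 1")
    case False
    then show ?thesis using unstable_tilted[OF \<alpha> \<gamma> x _ _ i eqs(4)] h ri r1 by simp
  next
    case True
    then have G: "vecG x = 0" using level_set_inner(1)[OF x] ri by simp
    then have "difR x = 0" using eqs(4) True \<alpha> ri by auto
    then have xs: "x = state_of (sumR x) 0 0 1"
      using state_of_level_set[OF x] G ri True by simp
    show ?thesis
    proof (cases "sumR x = 0")
      case True
      then show ?thesis using unstable_at_rest[OF \<alpha> \<gamma> x] xs by simp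
    next
      case False
      then show ?thesis using unstable_aligned[OF \<alpha> \<gamma> x xs] by simp
    qed
  qed
qed

theorem theorem3p4:
  fixes I4 \<gamma> :: real and lam rho R1 R2 gL :: quat
  assumes "I4 > 0" and "\<gamma> > 0"
    and "lam \<in> Im_quat" and "rho \<in> Im_quat"
    and "(R1, R2, gL) \<in> level_set lam rho"
    and "relative_equilibrium (top_alpha I4) \<gamma> lam rho (orbit (R1, R2, gL))"
  shows "(top_angle gL < pi / 2 \<longrightarrow>
            linearly_unstable (top_alpha I4) \<gamma> lam rho (R1, R2, gL)) \<and>
         (top_angle gL > pi / 2 \<or> (top_angle gL = pi / 2 \<and> norm R1 \<noteq> norm R2) \<longrightarrow>
            lyapunov_stable (top_alpha I4) \<gamma> lam rho (orbit (R1, R2, gL)))"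
proof -
  let ?x = "(R1, R2, gL)"
  have \<alpha>: "top_alpha I4 > 0" using assms(1) by (simp add: top_alpha_def)
  have re: "reG ?x = fst gL" by (simp add: reG_def)
  have "(fst gL)\<^sup>2 \<le> 1"
    using level_set_inner(1)[OF assms(5)] re by (metis diff_ge_0_iff_ge inner_ge_zero)
  then have "\<bar>fst gL\<bar> \<le> 1" by (simp add: abs_square_le_1)
  then have r: "- 1 \<le> fst gL" "fst gL \<le> 1" by auto
  have up: "fst gL > 0" if "top_angle gL < pi / 2"
    using that r arccos_le_arccos[of "fst gL" 0] by (force simp: top_angle_def arccos_0)
  have down: "fst gL < 0" if "top_angle gL > pi / 2"
    using that r arccos_le_arccos[of 0 "fst gL"] by (force simp: top_angle_def arccos_0)
  have hor: "fst gL = 0" if "top_angle gL = pi / 2"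
    using that cos_arccos[OF r] cos_pi_half unfolding top_angle_def by metis
  have "sumR ?x \<bullet> difR ?x = (norm R1)\<^sup>2 - (norm R2)\<^sup>2"
  proof -
    have "norm R1 = norm (snd R1)" "norm R2 = norm (snd R2)"
      using assms(5) by (simp_all add: level_set_iff norm_prod_def)
    then show ?thesis
      by (simp add: sumR_def difR_def inner_simps inner_commute power2_norm_eq_inner)
  qed
  then have "sumR ?x \<bullet> difR ?x \<noteq> 0" if "norm R1 \<noteq> norm R2"
    using that by simp
  then show ?thesis
    using upright_unstable[OF \<alpha> assms(2,5,6)] hanging_or_horizontal_stable[OF \<alpha> assms(2,5,6)]
      up down hor re by auto
qed

end
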